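(* For any Tambara functor $T\ne0$ on $G$, the following are equivalent. (1) $T$ is field-like. (2) $T$ satisfies (MRC), and the ring $T(G/e)$ has no non-trivial $G$-invariant ideal (that is, its only $G$-invariant ideals are $0$ and $T(G/e)$).
   Context: $G$ is a fixed finite group, $e$ denotes its unit and also the trivial subgroup; ${}_G\mathrm{set}$ is the category of finite $G$-sets and $G$-equivariant maps. Rings and monoids are commutative with unit. Semi-Mackey functor $M=(M^*,M_* )$ on $G$: a contravariant functor $M^*$ and a covariant functor $M_*$ from ${}_G\mathrm{set}$ to sets with $M^*(X)=M_*(X)=:M(X)$ such that (a) $M^*$ sends finite coproducts to products; (b) for every pull-back square with $f\colon X\to Y$, $\eta\colon Y'\to Y$, $\xi\colon X'\to X$, $f'\colon X'\to Y'$ one has $M^*(\eta)M_*(f)=M_*(f')M^*(\xi)$. Each $M(X)$ is then a commutative monoid (operation $M_*(\nabla)$, $\nabla\colon X\amalg X\to X$ the folding map). It is a Mackey functor if all $M(X)$ are abelian groups. Exponential diagram of $X\overset{p}{\leftarrow}A$ and $f\colon X\to Y$: up to isomorphism, $\Pi=\{(y,\sigma)\mid y\in Y,\ \sigma\colon f^{-1}(y)\to A \text{ a map of sets},\ p\circ\sigma=\mathrm{id}\}$ with $G$-action by conjugating $\sigma$, $\pi\colon\Pi\to Y$, $\pi(y,\sigma)=y$, $Z=X\times_Y\Pi$, $\rho\colon Z\to\Pi$ the projection, $\lambda\colon Z\to A$, $\lambda(x,(y,\sigma))=\sigma(x)$. Tambara functor $T=(T^*,T_+,T_\bullet)$ on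 $G$: $T^*$ contravariant, $T_+,T_\bullet$ covariant functors ${}_G\mathrm{set}\to\mathrm{Set}$ such that $(T^*,T_+)$ is a Mackey functor, $(T^*,T_\bullet)$ is a semi-Mackey functor, and $T_\bullet(f)T_+(p)=T_+(\pi)T_\bullet(\rho)T^*(\lambda)$ for every exponential diagram. Each $T(X)$ is a ring. For $f\colon X\to Y$ write $f^*=T^*(f)$ (a ring homomorphism), $f_+=T_+(f)$ (additive), $f_\bullet=T_\bullet(f)$ (multiplicative). $G$ acts on $T(G/e)$ by ring automorphisms through the structure morphisms associated with the $G$-automorphisms of $G/e$. An ideal $\mathscr{I}$ of $T$ is a family of ideals $\mathscr{I}(X)\subseteq T(X)$ such that for every $f\colon X\to Y$: $f^*(\mathscr{I}(Y))\subseteq\mathscr{I}(X)$, $f_+(\mathscr{I}(X))\subseteq\mathscr{I}(Y)$, $f_\bullet(\mathscr{I}(X))\subseteq f_\bullet(0)+\mathscr{I}(Y)$. An ideal $\mathfrak{m}\subsetneq T$ is maximal if it is maximal with respect to inclusion among ideals not equal to $T$. $T$ is field-like if the zero ideal $(0)\subsetneq T$ (with $(0)(X)=0$ for all $X$) is maximal. $T$ satisfies (MRC) if for every $G$-map $f\colon X\to Y$ between transitive finite $G$-sets, $f^*\colon T(Y)\to T(X)$ is injective. *)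

theory Defs
  imports "HOL-Algebra.Group_Action" "HOL-Algebra.Left_Coset" "HOL-Algebra.Ideal"
begin

section \<open>Finite G-sets\<close>

record ('g, 'x) gset =
  pts :: "'x set"
  act :: "'g \<Rightarrow> 'x \<Rightarrow> 'x"

definition fin_gset :: "('g, 'm) monoid_scheme \<Rightarrow> ('g, 'x) gset \<Rightarrow> bool" where
  "fin_gset G X \<longleftrightarrow> finite (pts X) \<and> group_action G (pts X) (act X)"

text \<open>Transitive G-sets are nonempty by convention; the locale \<^locale>\<open>transitive_action\<close>
  alone would admit the empty set.\<close>

definition transitive_gset :: "('g, 'm) monoid_scheme \<Rightarrow> ('g, 'x) gset \<Rightarrow> bool" where
  "transitive_gset G X \<longleftrightarrow>
     finite (pts X) \<and> pts X \<noteq> {} \<and> transitive_action G (pts X) (act X)"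

text \<open>Morphisms are extensional, so that equality of morphisms is equality of functions.\<close>

definition gmaps ::
  "('g, 'm) monoid_scheme \<Rightarrow> ('g, 'x) gset \<Rightarrow> ('g, 'y) gset \<Rightarrow> ('x \<Rightarrow> 'y) set" where
  "gmaps G X Y = {f \<in> pts X \<rightarrow>\<^sub>E pts Y.
     \<forall>g\<in>carrier G. \<forall>x\<in>pts X. f (act X g x) = act Y g (f x)}"

abbreviation gid :: "('g, 'x) gset \<Rightarrow> 'x \<Rightarrow> 'x" where
  "gid X \<equiv> (\<lambda>x\<in>pts X. x)"

abbreviation gcomp :: "('g, 'x) gset \<Rightarrow> ('y \<Rightarrow> 'z) \<Rightarrow> ('x \<Rightarrow> 'y) \<Rightarrow> 'x \<Rightarrow> 'z" where
  "gcomp X k f \<equiv> compose (pts X) k f"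

definition gset_iso ::
  "('g, 'm) monoid_scheme \<Rightarrow> ('g, 'x) gset \<Rightarrow> ('g, 'y) gset \<Rightarrow> ('x \<Rightarrow> 'y) \<Rightarrow> bool" where
  "gset_iso G X Y h \<longleftrightarrow> h \<in> gmaps G X Y \<and> bij_betw h (pts X) (pts Y)"

text \<open>The G-set of left cosets of a subgroup, with left translation.\<close>

definition coset_gset :: "('g, 'm) monoid_scheme \<Rightarrow> 'g set \<Rightarrow> ('g, 'g set) gset" where
  "coset_gset G H =
     \<lparr>pts = lcosets\<^bsub>G\<^esub> H, act = (\<lambda>g. \<lambda>C \<in> lcosets\<^bsub>G\<^esub> H. g <#\<^bsub>G\<^esub> C)\<rparr>"

text \<open>Universal properties are tested against the finite G-sets whose points lie in the type
  \<open>'u\<close>.  If \<open>'u\<close> is infinite, every finite G-set is isomorphic to such a one, so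
  this is a category equivalent to that of all finite G-sets.\<close>

definition is_coproduct ::
  "('g, 'm) monoid_scheme \<Rightarrow> ('g, 'u) gset \<Rightarrow> ('g, 'u) gset \<Rightarrow> ('g, 'u) gset \<Rightarrow>
   ('u \<Rightarrow> 'u) \<Rightarrow> ('u \<Rightarrow> 'u) \<Rightarrow> bool" where
  "is_coproduct G X Y C i j \<longleftrightarrow>
     fin_gset G X \<and> fin_gset G Y \<and> fin_gset G C \<and> i \<in> gmaps G X C \<and> j \<in> gmaps G Y C \<and>
     (\<forall>(W :: ('g, 'u) gset) u v. fin_gset G W \<and> u \<in> gmaps G X W \<and> v \<in> gmaps G Y W \<longrightarrow>
        (\<exists>!t. t \<in> gmaps G C W \<and> gcomp X t i = u \<and> gcomp Y t j = v))"

text \<open>The square with top \<open>f' : X' \<rightarrow> Y'\<close>, bottom \<open>f : X \<rightarrow> Y\<close> and vertical maps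
  \<open>\<xi> : X' \<rightarrow> X\<close>, \<open>\<eta> : Y' \<rightarrow> Y\<close>.\<close>

definition is_pullback ::
  "('g, 'm) monoid_scheme \<Rightarrow>
   ('g, 'u) gset \<Rightarrow> ('g, 'u) gset \<Rightarrow> ('g, 'u) gset \<Rightarrow> ('g, 'u) gset \<Rightarrow>
   ('u \<Rightarrow> 'u) \<Rightarrow> ('u \<Rightarrow> 'u) \<Rightarrow> ('u \<Rightarrow> 'u) \<Rightarrow> ('u \<Rightarrow> 'u) \<Rightarrow> bool" where
  "is_pullback G X' Y' X Y f' \<xi> \<eta> f \<longleftrightarrow>
     fin_gset G X' \<and> fin_gset G Y' \<and> fin_gset G X \<and> fin_gset G Y \<and>
     f' \<in> gmaps G X' Y' \<and> \<xi> \<in> gmaps G X' X \<and> \<eta> \<in> gmaps G Y' Y \<and> f \<in> gmaps G X Y \<and>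
     gcomp X' f \<xi> = gcomp X' \<eta> f' \<and>
     (\<forall>(W :: ('g, 'u) gset) u v. fin_gset G W \<and> u \<in> gmaps G W X \<and> v \<in> gmaps G W Y' \<and> gcomp W f u = gcomp W \<eta> v \<longrightarrow>
        (\<exists>!t. t \<in> gmaps G W X' \<and> gcomp W \<xi> t = u \<and> gcomp W f' t = v))"

section \<open>Exponential diagrams\<close>

definition fib :: "('g, 'x) gset \<Rightarrow> ('x \<Rightarrow> 'y) \<Rightarrow> 'y \<Rightarrow> 'x set" where
  "fib X f y = {x \<in> pts X. f x = y}"

text \<open>Points are pairs \<open>(y, \<sigma>)\<close> of a point of \<open>Y\<close> and a section \<open>\<sigma>\<close> of \<open>p\<close>
  over the fibre of \<open>f\<close> at \<open>y\<close>; the group acts by conjugating \<open>\<sigma>\<close>.\<close>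

definition dep_prod_pts ::
  "('g, 'a) gset \<Rightarrow> ('g, 'x) gset \<Rightarrow> ('g, 'y) gset \<Rightarrow> ('a \<Rightarrow> 'x) \<Rightarrow> ('x \<Rightarrow> 'y) \<Rightarrow>
   ('y \<times> ('x \<Rightarrow> 'a)) set" where
  "dep_prod_pts A X Y p f =
     {(y, \<sigma>). y \<in> pts Y \<and> \<sigma> \<in> fib X f y \<rightarrow>\<^sub>E pts A \<and> (\<forall>x\<in>fib X f y. p (\<sigma> x) = x)}"

definition dep_prod ::
  "('g, 'm) monoid_scheme \<Rightarrow> ('g, 'a) gset \<Rightarrow> ('g, 'x) gset \<Rightarrow> ('g, 'y) gset \<Rightarrow>
   ('a \<Rightarrow> 'x) \<Rightarrow> ('x \<Rightarrow> 'y) \<Rightarrow> ('g, 'y \<times> ('x \<Rightarrow> 'a)) gset" where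
  "dep_prod G A X Y p f =
     \<lparr>pts = dep_prod_pts A X Y p f,
      act = (\<lambda>g. \<lambda>(y, \<sigma>) \<in> dep_prod_pts A X Y p f.
        (act Y g y,
         \<lambda>x \<in> fib X f (act Y g y). act A g (\<sigma> (act X (inv\<^bsub>G\<^esub> g) x))))\<rparr>"

definition fib_prod_pts ::
  "('g, 'x) gset \<Rightarrow> ('g, 'b) gset \<Rightarrow> ('x \<Rightarrow> 'y) \<Rightarrow> ('b \<Rightarrow> 'y) \<Rightarrow> ('x \<times> 'b) set" where
  "fib_prod_pts X B f q = {(x, b). x \<in> pts X \<and> b \<in> pts B \<and> f x = q b}"

definition fib_prod ::
  "('g, 'x) gset \<Rightarrow> ('g, 'b) gset \<Rightarrow> ('x \<Rightarrow> 'y) \<Rightarrow> ('b \<Rightarrow> 'y) \<Rightarrow> ('g, 'x \<times> 'b) gset" where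
  "fib_prod X B f q =
     \<lparr>pts = fib_prod_pts X B f q,
      act = (\<lambda>g. \<lambda>(x, b) \<in> fib_prod_pts X B f q. (act X g x, act B g b))\<rparr>"

text \<open>A diagram \<open>A \<leftarrow>\<^sub>l Z \<rightarrow>\<^sub>r P \<rightarrow>\<^sub>q Y\<close> which \<open>h\<close> and \<open>k\<close> identify
  with the standard exponential diagram of \<open>p : A \<rightarrow> X\<close> and \<open>f : X \<rightarrow> Y\<close>: \<open>P\<close> with
  the dependent product, \<open>Z\<close> with its pull-back along \<open>f\<close>, \<open>q\<close> and \<open>r\<close> with the
  projections, and \<open>l\<close> with the evaluation \<open>(x, (y, \<sigma>)) \<mapsto> \<sigma> x\<close>.\<close>

definition is_exponential ::
  "('g, 'm) monoid_scheme \<Rightarrow>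
   ('g, 'u) gset \<Rightarrow> ('g, 'u) gset \<Rightarrow> ('g, 'u) gset \<Rightarrow> ('g, 'u) gset \<Rightarrow> ('g, 'u) gset \<Rightarrow>
   ('u \<Rightarrow> 'u) \<Rightarrow> ('u \<Rightarrow> 'u) \<Rightarrow> ('u \<Rightarrow> 'u) \<Rightarrow> ('u \<Rightarrow> 'u) \<Rightarrow> ('u \<Rightarrow> 'u) \<Rightarrow> bool" where
  "is_exponential G A X Y Z P p f l r q \<longleftrightarrow>
     fin_gset G A \<and> fin_gset G X \<and> fin_gset G Y \<and> fin_gset G Z \<and> fin_gset G P \<and>
     p \<in> gmaps G A X \<and> f \<in> gmaps G X Y \<and>
     l \<in> gmaps G Z A \<and> r \<in> gmaps G Z P \<and> q \<in> gmaps G P Y \<and>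
     (\<exists>h k. gset_iso G P (dep_prod G A X Y p f) h \<and>
            gset_iso G Z (fib_prod X (dep_prod G A X Y p f) f fst) k \<and>
            (\<forall>w\<in>pts P. q w = fst (h w)) \<and>
            (\<forall>z\<in>pts Z. h (r z) = snd (k z)) \<and>
            (\<forall>z\<in>pts Z. l z = snd (snd (k z)) (fst (k z))))"

section \<open>Mackey and Tambara functors\<close>

text \<open>A functor with values \<open>V X\<close> has its morphism part indexed by source and target:
  \<open>R X Y f : V Y \<rightarrow> V X\<close> in the contravariant and \<open>S X Y f : V X \<rightarrow> V Y\<close> in the
  covariant case.  Values outside the finite G-sets and their morphisms carry no meaning.\<close>

type_synonym ('g, 'u, 'a) gobj = "('g, 'u) gset \<Rightarrow> 'a set"
type_synonym ('g, 'u, 'a) gmor = "('g, 'u) gset \<Rightarrow> ('g, 'u) gset \<Rightarrow> ('u \<Rightarrow> 'u) \<Rightarrow> 'a \<Rightarrow> 'a"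

definition contra_functor ::
  "('g, 'm) monoid_scheme \<Rightarrow> ('g, 'u, 'a) gobj \<Rightarrow> ('g, 'u, 'a) gmor \<Rightarrow> bool" where
  "contra_functor G V R \<longleftrightarrow>
     (\<forall>X Y f. fin_gset G X \<and> fin_gset G Y \<and> f \<in> gmaps G X Y \<longrightarrow> R X Y f \<in> V Y \<rightarrow> V X) \<and>
     (\<forall>X. fin_gset G X \<longrightarrow> (\<forall>a\<in>V X. R X X (gid X) a = a)) \<and>
     (\<forall>X Y Z f k. fin_gset G X \<and> fin_gset G Y \<and> fin_gset G Z \<and>
        f \<in> gmaps G X Y \<and> k \<in> gmaps G Y Z \<longrightarrow>
        (\<forall>a\<in>V Z. R X Z (gcomp X k f) a = R X Y f (R Y Z k a)))"

definition co_functor ::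
  "('g, 'm) monoid_scheme \<Rightarrow> ('g, 'u, 'a) gobj \<Rightarrow> ('g, 'u, 'a) gmor \<Rightarrow> bool" where
  "co_functor G V S \<longleftrightarrow>
     (\<forall>X Y f. fin_gset G X \<and> fin_gset G Y \<and> f \<in> gmaps G X Y \<longrightarrow> S X Y f \<in> V X \<rightarrow> V Y) \<and>
     (\<forall>X. fin_gset G X \<longrightarrow> (\<forall>a\<in>V X. S X X (gid X) a = a)) \<and>
     (\<forall>X Y Z f k. fin_gset G X \<and> fin_gset G Y \<and> fin_gset G Z \<and>
        f \<in> gmaps G X Y \<and> k \<in> gmaps G Y Z \<longrightarrow>
        (\<forall>a\<in>V X. S X Z (gcomp X k f) a = S Y Z k (S X Y f a)))"

text \<open>Finite coproducts: the empty one and the binary ones.\<close>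

definition semi_mackey ::
  "('g, 'm) monoid_scheme \<Rightarrow>
   ('g, 'u, 'a) gobj \<Rightarrow> ('g, 'u, 'a) gmor \<Rightarrow> ('g, 'u, 'a) gmor \<Rightarrow> bool" where
  "semi_mackey G V R S \<longleftrightarrow>
     contra_functor G V R \<and> co_functor G V S \<and>
     (\<forall>X. fin_gset G X \<and> pts X = {} \<longrightarrow> (\<exists>!a. a \<in> V X)) \<and>
     (\<forall>X Y C i j. is_coproduct G X Y C i j \<longrightarrow>
        bij_betw (\<lambda>c. (R X C i c, R Y C j c)) (V C) (V X \<times> V Y)) \<and>
     (\<forall>X' Y' X Y f' \<xi> \<eta> f. is_pullback G X' Y' X Y f' \<xi> \<eta> f \<longrightarrow>
        (\<forall>a\<in>V X. R Y' Y \<eta> (S X Y f a) = S X' Y' f' (R X' X \<xi> a)))"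

text \<open>The operation on \<open>V X\<close> is \<open>V X \<times> V X \<cong> V (X \<amalg> X) \<rightarrow> V X\<close>, the last map being
  \<open>S\<close> of the folding map \<open>n\<close>; the unit is the image of the unique element of the value at
  the empty G-set.  For a semi-Mackey functor neither depends on the chosen coproduct.\<close>

definition fold_op ::
  "('g, 'm) monoid_scheme \<Rightarrow> ('g, 'u, 'a) gobj \<Rightarrow> ('g, 'u, 'a) gmor \<Rightarrow> ('g, 'u, 'a) gmor \<Rightarrow>
   ('g, 'u) gset \<Rightarrow> 'a \<Rightarrow> 'a \<Rightarrow> 'a" where
  "fold_op G V R S X a b =
     (THE s. \<exists>C i j n c. is_coproduct G X X C i j \<and>
        n \<in> gmaps G C X \<and> gcomp X n i = gid X \<and> gcomp X n j = gid X \<and>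
        c \<in> V C \<and> R X C i c = a \<and> R X C j c = b \<and> s = S C X n c)"

definition fold_unit ::
  "('g, 'm) monoid_scheme \<Rightarrow> ('g, 'u, 'a) gobj \<Rightarrow> ('g, 'u, 'a) gmor \<Rightarrow>
   ('g, 'u) gset \<Rightarrow> 'a" where
  "fold_unit G V S X =
     (THE s. \<exists>E u c. fin_gset G E \<and> pts E = {} \<and> u \<in> gmaps G E X \<and> c \<in> V E \<and> s = S E X u c)"

definition fold_monoid ::
  "('g, 'm) monoid_scheme \<Rightarrow> ('g, 'u, 'a) gobj \<Rightarrow> ('g, 'u, 'a) gmor \<Rightarrow> ('g, 'u, 'a) gmor \<Rightarrow>
   ('g, 'u) gset \<Rightarrow> 'a monoid" where
  "fold_monoid G V R S X =
     \<lparr>carrier = V X, mult = fold_op G V R S X, one = fold_unit G V S X\<rparr>"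

definition mackey ::
  "('g, 'm) monoid_scheme \<Rightarrow>
   ('g, 'u, 'a) gobj \<Rightarrow> ('g, 'u, 'a) gmor \<Rightarrow> ('g, 'u, 'a) gmor \<Rightarrow> bool" where
  "mackey G V R S \<longleftrightarrow>
     semi_mackey G V R S \<and> (\<forall>X. fin_gset G X \<longrightarrow> comm_group (fold_monoid G V R S X))"

text \<open>\<open>res\<close>, \<open>tran\<close>, \<open>nrm\<close> are \<open>T\<^sup>*\<close>, \<open>T\<^sub>+\<close> and \<open>T\<^sub>\<bullet>\<close>.\<close>

record ('g, 'u, 'a) tambara =
  val :: "('g, 'u, 'a) gobj"
  res :: "('g, 'u, 'a) gmor"
  tran :: "('g, 'u, 'a) gmor"
  nrm :: "('g, 'u, 'a) gmor"

definition tambara_functor ::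
  "('g, 'm) monoid_scheme \<Rightarrow> ('g, 'u, 'a) tambara \<Rightarrow> bool" where
  "tambara_functor G T \<longleftrightarrow>
     mackey G (val T) (res T) (tran T) \<and>
     semi_mackey G (val T) (res T) (nrm T) \<and>
     (\<forall>A X Y Z P p f l r q. is_exponential G A X Y Z P p f l r q \<longrightarrow>
        (\<forall>a\<in>val T A. nrm T X Y f (tran T A X p a) = tran T P Y q (nrm T Z P r (res T Z A l a))))"

definition tring ::
  "('g, 'm) monoid_scheme \<Rightarrow> ('g, 'u, 'a) tambara \<Rightarrow> ('g, 'u) gset \<Rightarrow> 'a ring" where
  "tring G T X =
     \<lparr>carrier = val T X,
      mult = fold_op G (val T) (res T) (nrm T) X,
      one = fold_unit G (val T) (nrm T) X,
      zero = fold_unit G (val T) (tran T) X,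
      add = fold_op G (val T) (res T) (tran T) X\<rparr>"

definition nonzero_tambara ::
  "('g, 'm) monoid_scheme \<Rightarrow> ('g, 'u, 'a) tambara \<Rightarrow> bool" where
  "nonzero_tambara G T \<longleftrightarrow> (\<exists>X. fin_gset G X \<and> val T X \<noteq> {\<zero>\<^bsub>tring G T X\<^esub>})"

section \<open>Ideals\<close>

definition tambara_ideal ::
  "('g, 'm) monoid_scheme \<Rightarrow> ('g, 'u, 'a) tambara \<Rightarrow> ('g, 'u, 'a) gobj \<Rightarrow> bool" where
  "tambara_ideal G T I \<longleftrightarrow>
     (\<forall>X. fin_gset G X \<longrightarrow> ideal (I X) (tring G T X)) \<and>
     (\<forall>X Y f. fin_gset G X \<and> fin_gset G Y \<and> f \<in> gmaps G X Y \<longrightarrow>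
        res T X Y f ` I Y \<subseteq> I X \<and>
        tran T X Y f ` I X \<subseteq> I Y \<and>
        nrm T X Y f ` I X \<subseteq>
          {nrm T X Y f \<zero>\<^bsub>tring G T X\<^esub> \<oplus>\<^bsub>tring G T Y\<^esub> b | b. b \<in> I Y})"

definition ideal_le ::
  "('g, 'm) monoid_scheme \<Rightarrow> ('g, 'u, 'a) gobj \<Rightarrow> ('g, 'u, 'a) gobj \<Rightarrow> bool" where
  "ideal_le G I J \<longleftrightarrow> (\<forall>X. fin_gset G X \<longrightarrow> I X \<subseteq> J X)"

definition proper_tambara_ideal ::
  "('g, 'm) monoid_scheme \<Rightarrow> ('g, 'u, 'a) tambara \<Rightarrow> ('g, 'u, 'a) gobj \<Rightarrow> bool" where
  "proper_tambara_ideal G T I \<longleftrightarrow>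
     tambara_ideal G T I \<and> (\<exists>X. fin_gset G X \<and> I X \<noteq> val T X)"

definition maximal_tambara_ideal ::
  "('g, 'm) monoid_scheme \<Rightarrow> ('g, 'u, 'a) tambara \<Rightarrow> ('g, 'u, 'a) gobj \<Rightarrow> bool" where
  "maximal_tambara_ideal G T M \<longleftrightarrow>
     proper_tambara_ideal G T M \<and>
     (\<forall>J. proper_tambara_ideal G T J \<and> ideal_le G M J \<longrightarrow> ideal_le G J M)"

definition field_like ::
  "('g, 'm) monoid_scheme \<Rightarrow> ('g, 'u, 'a) tambara \<Rightarrow> bool" where
  "field_like G T \<longleftrightarrow> maximal_tambara_ideal G T (\<lambda>X. {\<zero>\<^bsub>tring G T X\<^esub>})"

definition MRC :: "('g, 'm) monoid_scheme \<Rightarrow> ('g, 'u, 'a) tambara \<Rightarrow> bool" where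
  "MRC G T \<longleftrightarrow>
     (\<forall>X Y f. transitive_gset G X \<and> transitive_gset G Y \<and> f \<in> gmaps G X Y \<longrightarrow>
        inj_on (res T X Y f) (val T Y))"

text \<open>Invariance of an ideal of \<open>T (G/e)\<close> under G, which acts through the automorphisms of the
  G-set \<open>G/e\<close>.  As \<open>s\<close> ranges over all of them (they form a group isomorphic to G), and
  \<open>T\<^sup>* (s\<inverse>) = T\<^sub>+ (s) = T\<^sub>\<bullet> (s)\<close>, the choice of structure morphism is immaterial.\<close>

definition invariant_ideal ::
  "('g, 'm) monoid_scheme \<Rightarrow> ('g, 'u, 'a) tambara \<Rightarrow> ('g, 'u) gset \<Rightarrow> 'a set \<Rightarrow> bool" where
  "invariant_ideal G T E J \<longleftrightarrow>
     ideal J (tring G T E) \<and> (\<forall>s. gset_iso G E E s \<longrightarrow> res T E E s ` J \<subseteq> J)"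

end

(* For a G-invariant ideal J of T(G/e) let I_J(X) consist of the a in T(X) whose pull-backs along all
   maps G/e -> X lie in J. By base change, the pull-back of a transfer (norm) along such a map is a
   transfer (norm) from a free G-set X' to G/e, that is, a sum (product) over the orbits of X', so
   I_J is an ideal of T with I_J(G/e) = J. If T is field-like, I_0 = 0, which is (MRC), and every
   proper J has I_J = 0, hence J = 0. Conversely let I be a proper ideal of T. Then I(G/e) does not
   contain 1, because the norm to a point would carry 1 into I there; so I(G/e) = 0, and (MRC) on each
   orbit forces I = 0. *)

theory Submission
  imports Defs "HOL-Algebra.RingHom"
begin

section \<open>Finite G-sets\<close>

text \<open>Two obstacles shape the argument. The ring structure on T(X) is not part of the data:
  sum and product are read off from folding maps of arbitrarily chosen coproducts. Independence of
  the choice, the monoid laws and compatibility with restriction have to be extracted from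
  additivity and base change, and the distributive law from one exponential diagram. Addition and
  multiplication share most of this, since both come from a semi-Mackey functor.

  The second obstacle is that norms need not preserve zero: over a point with empty fibre the norm
  is an empty product, hence a unit. This is why ideals constrain a norm only relative to the norm
  of 0, and why closure of the induced ideal is tested on a difference of two norms. If the
  pulled-back G-set is empty, the two norms cancel; otherwise each lies in the ideal J by itself,
  because a single orbit already contributes a factor in J. Along a surjection the norm of 0 is 0,
  which turns the relative condition into honest membership for the norm to a point.\<close>

definition gsub :: "('g, 'x) gset \<Rightarrow> 'x set \<Rightarrow> ('g, 'x) gset" where
  "gsub X U = \<lparr>pts = U, act = (\<lambda>g. restrict (act X g) U)\<rparr>"

text \<open>An elementwise form of \<open>is_coproduct\<close>: maps out of \<open>C\<close> can be
  built by cases and squares checked on points. Only the passage to the universal property is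
  proved, since the coproducts constructed below are all of this kind.\<close>

definition disjoint_union ::
  "('g, 'm) monoid_scheme \<Rightarrow> ('g, 'x) gset \<Rightarrow> ('g, 'y) gset \<Rightarrow> ('g, 'z) gset \<Rightarrow>
   ('x \<Rightarrow> 'z) \<Rightarrow> ('y \<Rightarrow> 'z) \<Rightarrow> bool" where
  "disjoint_union G X Y C i j \<longleftrightarrow>
     fin_gset G X \<and> fin_gset G Y \<and> fin_gset G C \<and> i \<in> gmaps G X C \<and> j \<in> gmaps G Y C \<and>
     inj_on i (pts X) \<and> inj_on j (pts Y) \<and> i ` pts X \<inter> j ` pts Y = {} \<and>
     pts C = i ` pts X \<union> j ` pts Y"

lemma gmaps_in: "f \<in> gmaps G X Y \<Longrightarrow> x \<in> pts X \<Longrightarrow> f x \<in> pts Y"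
  by (auto simp: gmaps_def)

lemma gmaps_act:
  "f \<in> gmaps G X Y \<Longrightarrow> g \<in> carrier G \<Longrightarrow> x \<in> pts X \<Longrightarrow> f (act X g x) = act Y g (f x)"
  by (auto simp: gmaps_def)

lemma gmaps_ext: "f \<in> gmaps G X Y \<Longrightarrow> f \<in> extensional (pts X)"
  by (auto simp: gmaps_def PiE_def)

lemma gmaps_eqI:
  "f \<in> gmaps G X Y \<Longrightarrow> k \<in> gmaps G X Y \<Longrightarrow> (\<And>x. x \<in> pts X \<Longrightarrow> f x = k x) \<Longrightarrow> f = k"
  by (blast intro: extensionalityI gmaps_ext)

lemma gcomp_eq_iff:
  "u \<in> gmaps G X W \<Longrightarrow> gcomp X t i = u \<longleftrightarrow> (\<forall>x\<in>pts X. t (i x) = u x)"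
  by (auto simp: compose_def fun_eq_iff gmaps_def PiE_def extensional_def)

lemma restrict_gmaps:
  assumes "\<And>x. x \<in> pts X \<Longrightarrow> f x \<in> pts Y"
    and "\<And>g x. g \<in> carrier G \<Longrightarrow> x \<in> pts X \<Longrightarrow> act X g x \<in> pts X"
    and "\<And>g x. g \<in> carrier G \<Longrightarrow> x \<in> pts X \<Longrightarrow> f (act X g x) = act Y g (f x)"
  shows "(\<lambda>x\<in>pts X. f x) \<in> gmaps G X Y"
  using assms by (auto simp: gmaps_def)

lemma fin_gset_finite: "fin_gset G X \<Longrightarrow> finite (pts X)"
  by (simp add: fin_gset_def)

lemma disjoint_unionD:
  assumes "disjoint_union G X Y C i j"
  shows "fin_gset G X" "fin_gset G Y" "fin_gset G C" "i \<in> gmaps G X C" "j \<in> gmaps G Y C"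
    "inj_on i (pts X)" "inj_on j (pts Y)" "i ` pts X \<inter> j ` pts Y = {}"
    "pts C = i ` pts X \<union> j ` pts Y"
  using assms by (auto simp: disjoint_union_def)

lemma disjoint_union_eqs:
  assumes "disjoint_union G X Y C i j"
  shows "x \<in> pts X \<Longrightarrow> x' \<in> pts X \<Longrightarrow> i x = i x' \<longleftrightarrow> x = x'"
    and "y \<in> pts Y \<Longrightarrow> y' \<in> pts Y \<Longrightarrow> j y = j y' \<longleftrightarrow> y = y'"
    and "x \<in> pts X \<Longrightarrow> y \<in> pts Y \<Longrightarrow> i x \<noteq> j y"
    and "x \<in> pts X \<Longrightarrow> y \<in> pts Y \<Longrightarrow> j y \<noteq> i x"
  using disjoint_unionD(6-8)[OF assms] by (auto simp: inj_on_def)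

lemma disjoint_union_cases:
  assumes "disjoint_union G X Y C i j" "z \<in> pts C"
  obtains x where "x \<in> pts X" "z = i x" | y where "y \<in> pts Y" "z = j y"
  using disjoint_unionD(9)[OF assms(1)] assms(2) by auto

lemma disjoint_union_swap: "disjoint_union G X Y C i j \<Longrightarrow> disjoint_union G Y X C j i"
  by (auto simp: disjoint_union_def)

section \<open>Actions, equivariant maps and change of the underlying type\<close>

context group
begin

lemma act_in: "fin_gset G X \<Longrightarrow> g \<in> carrier G \<Longrightarrow> x \<in> pts X \<Longrightarrow> act X g x \<in> pts X"
  unfolding fin_gset_def using group_action.element_image by fastforce

lemma act_one: "fin_gset G X \<Longrightarrow> x \<in> pts X \<Longrightarrow> act X \<one> x = x"
  unfolding fin_gset_def by (metis group_action.id_eq_one restrict_apply')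

lemma act_mult:
  "fin_gset G X \<Longrightarrow> g \<in> carrier G \<Longrightarrow> h \<in> carrier G \<Longrightarrow> x \<in> pts X \<Longrightarrow>
    act X (g \<otimes> h) x = act X g (act X h x)"
  unfolding fin_gset_def using group_action.composition_rule by metis

lemma act_inv:
  assumes "fin_gset G X" "g \<in> carrier G" "x \<in> pts X"
  shows "act X (inv g) (act X g x) = x" "act X g (act X (inv g) x) = x"
  using assms act_mult[of X "inv g" g x] act_mult[of X g "inv g" x] act_one[of X x] by simp_all

text \<open>Actions take values in \<open>BijGroup\<close>, whose elements are extensional
  bijections. Bijectivity is automatic, as \<open>inv g\<close> acts as the inverse of
  \<open>g\<close>; extensionality has to be asked for.\<close>

lemma fin_gsetI:
  assumes fin: "finite (pts X)"
    and ext: "\<And>g. g \<in> carrier G \<Longrightarrow> act X g \<in> extensional (pts X)"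
    and cl: "\<And>g x. g \<in> carrier G \<Longrightarrow> x \<in> pts X \<Longrightarrow> act X g x \<in> pts X"
    and one: "\<And>x. x \<in> pts X \<Longrightarrow> act X \<one> x = x"
    and mult: "\<And>g h x. g \<in> carrier G \<Longrightarrow> h \<in> carrier G \<Longrightarrow> x \<in> pts X \<Longrightarrow>
      act X (g \<otimes> h) x = act X g (act X h x)"
  shows "fin_gset G X"
proof -
  have B: "act X g \<in> Bij (pts X)" if "g \<in> carrier G" for g
  proof -
    have "bij_betw (act X g) (pts X) (pts X)"
      by (rule bij_betw_byWitness[where f' = "act X (inv g)"])
        (use that cl mult[of "inv g" g] mult[of g "inv g"] one in auto)
    then show ?thesis using ext[OF that] by (simp add: Bij_def)
  qed
  have "act X \<in> hom G (BijGroup (pts X))"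
  proof (rule homI)
    fix g h assume gh: "g \<in> carrier G" "h \<in> carrier G"
    have "act X (g \<otimes> h) = compose (pts X) (act X g) (act X h)"
      by (rule extensionalityI[of _ "pts X"])
        (use gh ext mult in \<open>auto simp: compose_def\<close>)
    then show "act X (g \<otimes> h) = act X g \<otimes>\<^bsub>BijGroup (pts X)\<^esub> act X h"
      using gh B by (simp add: BijGroup_def)
  qed (use B in \<open>simp add: BijGroup_def\<close>)
  then have "group_action G (pts X) (act X)"
    by (intro group_action.intro group_hom.intro group_hom_axioms.intro group_BijGroup)
      (auto intro: is_group)
  with fin show ?thesis by (simp add: fin_gset_def)
qed

lemma id_gmaps: "fin_gset G X \<Longrightarrow> gid X \<in> gmaps G X X"
  by (rule restrict_gmaps) (auto simp: act_in)

lemma comp_gmaps: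
  "fin_gset G X \<Longrightarrow> f \<in> gmaps G X Y \<Longrightarrow> k \<in> gmaps G Y Z \<Longrightarrow> (\<lambda>x\<in>pts X. k (f x)) \<in> gmaps G X Z"
  by (rule restrict_gmaps) (auto simp: act_in gmaps_in gmaps_act)

text \<open>On an empty domain extensionality leaves a single function, the constant
  \<open>undefined\<close>; it serves below as the map out of any empty G-set.\<close>

lemma empty_gmaps: "pts X = {} \<Longrightarrow> (\<lambda>_. undefined) \<in> gmaps G X Y"
  by (simp add: gmaps_def)

lemma gset_iso_inverse:
  assumes "fin_gset G X" "fin_gset G Y" "gset_iso G X Y h"
  obtains k where "gset_iso G Y X k" "\<And>x. x \<in> pts X \<Longrightarrow> k (h x) = x"
    "\<And>y. y \<in> pts Y \<Longrightarrow> h (k y) = y"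
proof
  have h: "h \<in> gmaps G X Y" and b: "bij_betw h (pts X) (pts Y)"
    using assms(3) by (auto simp: gset_iso_def)
  let ?k = "\<lambda>y\<in>pts Y. inv_into (pts X) h y"
  show *: "\<And>x. x \<in> pts X \<Longrightarrow> ?k (h x) = x"
    using b h by (simp add: gmaps_in bij_betw_inv_into_left)
  show **: "\<And>y. y \<in> pts Y \<Longrightarrow> h (?k y) = y"
    using b by (simp add: bij_betw_inv_into_right)
  have b': "bij_betw ?k (pts Y) (pts X)"
    by (rule bij_betw_byWitness[where f' = h])
      (use * ** b h gmaps_in[OF h] in \<open>auto simp: bij_betw_def inv_into_into\<close>)
  have "?k \<in> gmaps G Y X"
  proof (rule restrict_gmaps)
    fix g y assume g: "g \<in> carrier G" and y: "y \<in> pts Y"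
    obtain x where x: "x \<in> pts X" "y = h x"
      using b y by (auto simp: bij_betw_def)
    then show "inv_into (pts X) h (act Y g y) = act X g (inv_into (pts X) h y)"
      using g b gmaps_act[OF h g x(1)] act_in[OF assms(1) g x(1)]
      by (metis bij_betw_inv_into_left)
  qed (use b assms(2) in \<open>auto simp: act_in bij_betw_def inv_into_into\<close>)
  then show "gset_iso G Y X ?k" using b' by (simp add: gset_iso_def)
qed

text \<open>Functors and universal properties only see G-sets on the type \<open>'u\<close>, while
  sums and fibre products are built on other types. An infinite \<open>'u\<close> contains a finite
  set of every size, and the action is carried over along a bijection.\<close>

lemma gset_iso_exists:
  assumes "infinite (UNIV :: 'u set)" and B: "fin_gset G B"
  obtains X :: "('a, 'u) gset" and h where "fin_gset G X" "gset_iso G X B h"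
proof -
  obtain U :: "'u set" where "finite U" "card U = card (pts B)"
    using infinite_arbitrarily_large[OF assms(1)] by blast
  then obtain e where e: "bij_betw e U (pts B)"
    using finite_same_card_bij fin_gset_finite[OF B] by blast
  define d where "d = inv_into U e"
  have d: "d b \<in> U" "e (d b) = b" if "b \<in> pts B" for b
    using e that by (auto simp: d_def bij_betw_def inv_into_into f_inv_into_f)
  have de: "d (e x) = x" "e x \<in> pts B" if "x \<in> U" for x
    using e that by (auto simp: d_def bij_betw_def)
  let ?X = "\<lparr>pts = U, act = (\<lambda>g. \<lambda>x\<in>U. d (act B g (e x)))\<rparr>"
  have "fin_gset G ?X"
    by (rule fin_gsetI) (auto simp: \<open>finite U\<close> d de act_in[OF B] act_one[OF B] act_mult[OF B])
  moreover have "gset_iso G ?X B (\<lambda>x\<in>U. e x)"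
    using e by (auto simp: gset_iso_def gmaps_def de d act_in[OF B] bij_betw_def inj_on_def)
  ultimately show ?thesis using that by blast
qed

section \<open>Invariant subsets, disjoint unions and pull-back squares\<close>

lemma gsub_sel [simp]: "pts (gsub X U) = U" "x \<in> U \<Longrightarrow> act (gsub X U) g x = act X g x"
  by (auto simp: gsub_def)

lemma fin_gset_gsub:
  assumes "fin_gset G X" "U \<subseteq> pts X"
    and "\<And>g x. g \<in> carrier G \<Longrightarrow> x \<in> U \<Longrightarrow> act X g x \<in> U"
  shows "fin_gset G (gsub X U)" and "gid (gsub X U) \<in> gmaps G (gsub X U) X"
proof -
  show "fin_gset G (gsub X U)"
    by (rule fin_gsetI)
      (use assms finite_subset[OF assms(2)] in
        \<open>auto simp: fin_gset_finite act_one act_mult subsetD, auto simp: gsub_def\<close>)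
  show "gid (gsub X U) \<in> gmaps G (gsub X U) X"
    by (rule restrict_gmaps) (use assms in auto)
qed

text \<open>A point outside the image that moved into it could be moved back by the inverse, so the
  complement is invariant. This is the device for splitting off a single summand or orbit.\<close>

lemma disjoint_union_complement:
  assumes X: "fin_gset G X" and C: "fin_gset G C" and i: "i \<in> gmaps G X C"
    and inj: "inj_on i (pts X)"
  defines "Y \<equiv> gsub C (pts C - i ` pts X)"
  shows "disjoint_union G X Y C i (gid Y)"
proof -
  have *: "act C g z \<in> pts C - i ` pts X" if g: "g \<in> carrier G" and z: "z \<in> pts C - i ` pts X" for g z
  proof -
    have "act C g z \<notin> i ` pts X"
    proof
      assume "act C g z \<in> i ` pts X"
      then obtain x where x: "x \<in> pts X" "act C g z = i x" by auto
      then have "z = i (act X (inv g) x)"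
        using act_inv(1)[OF C g, of z] z gmaps_act[OF i _ x(1), of "inv g"] g by auto
      then show False using z act_in[OF X _ x(1), of "inv g"] g by auto
    qed
    then show ?thesis using act_in[OF C g] z by auto
  qed
  show ?thesis
    unfolding disjoint_union_def Y_def
    using assms fin_gset_gsub[OF C _ *] gmaps_in[OF i] by auto
qed

lemma disjoint_union_map:
  assumes du: "disjoint_union G X Y C i j" and u: "u \<in> gmaps G X W" and v: "v \<in> gmaps G Y W"
  obtains t where "t \<in> gmaps G C W" "\<And>x. x \<in> pts X \<Longrightarrow> t (i x) = u x"
    "\<And>y. y \<in> pts Y \<Longrightarrow> t (j y) = v y"
proof
  note d = disjoint_unionD[OF du]
  define t where
    "t = (\<lambda>z. if z \<in> i ` pts X then u (inv_into (pts X) i z) else v (inv_into (pts Y) j z))"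
  have 1: "t (i x) = u x" if "x \<in> pts X" for x
    using that d(6) gmaps_in[OF d(4)] by (auto simp: t_def)
  have 2: "t (j y) = v y" if "y \<in> pts Y" for y
    using that d(7,8) gmaps_in[OF d(5)] by (auto simp: t_def)
  show "restrict t (pts C) (i x) = u x" if "x \<in> pts X" for x
    using that gmaps_in[OF d(4)] 1 by simp
  show "restrict t (pts C) (j y) = v y" if "y \<in> pts Y" for y
    using that gmaps_in[OF d(5)] 2 by simp
  show "restrict t (pts C) \<in> gmaps G C W"
  proof (rule restrict_gmaps)
    fix z assume "z \<in> pts C"
    with du show "t z \<in> pts W"
      by (cases rule: disjoint_union_cases) (simp_all add: 1 2 gmaps_in[OF u] gmaps_in[OF v])
  next
    fix g z assume g: "g \<in> carrier G" and "z \<in> pts C"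
    from du this(2) show "t (act C g z) = act W g (t z)"
      by (cases rule: disjoint_union_cases)
        (simp_all add: 1 2 g act_in[OF d(1)] act_in[OF d(2)] gmaps_act[OF u] gmaps_act[OF v]
          gmaps_act[OF d(4), symmetric] gmaps_act[OF d(5), symmetric])
  qed (simp add: act_in[OF d(3)])
qed

lemma disjoint_union_eqI:
  assumes du: "disjoint_union G X Y C i j" and "s \<in> gmaps G C W" "t \<in> gmaps G C W"
    and "\<And>x. x \<in> pts X \<Longrightarrow> s (i x) = t (i x)" "\<And>y. y \<in> pts Y \<Longrightarrow> s (j y) = t (j y)"
  shows "s = t"
  using assms(2,3) by (rule gmaps_eqI) (use assms(4,5) in \<open>auto elim: disjoint_union_cases[OF du]\<close>)

lemma disjoint_union_is_coproduct:
  assumes du: "disjoint_union G X Y C i j"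
  shows "is_coproduct G X Y C i j"
  unfolding is_coproduct_def
proof (intro conjI allI impI, goal_cases)
  case (6 W u v)
  then have u: "u \<in> gmaps G X W" and v: "v \<in> gmaps G Y W" by auto
  obtain t where t: "t \<in> gmaps G C W" "\<And>x. x \<in> pts X \<Longrightarrow> t (i x) = u x"
    "\<And>y. y \<in> pts Y \<Longrightarrow> t (j y) = v y"
    using disjoint_union_map[OF du u v] by blast
  show ?case
  proof (rule ex1I[of _ t])
    show "t \<in> gmaps G C W \<and> gcomp X t i = u \<and> gcomp Y t j = v"
      using t by (simp add: gcomp_eq_iff[OF u] gcomp_eq_iff[OF v])
    show "s = t" if "s \<in> gmaps G C W \<and> gcomp X s i = u \<and> gcomp Y s j = v" for s
      using that t by (intro disjoint_union_eqI[OF du]) (auto simp: gcomp_eq_iff[OF u] gcomp_eq_iff[OF v])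
  qed
qed (use disjoint_unionD[OF du] in auto)

lemma disjoint_union_exists:
  assumes "infinite (UNIV :: 'u set)" and X: "fin_gset G X" and Y: "fin_gset G Y"
  obtains C :: "('a, 'u) gset" and i j where "disjoint_union G X Y C i j"
proof -
  let ?S = "\<lparr>pts = pts X <+> pts Y,
    act = (\<lambda>g. \<lambda>z\<in>pts X <+> pts Y. map_sum (act X g) (act Y g) z)\<rparr>"
  have S: "fin_gset G ?S"
    by (rule fin_gsetI)
      (auto simp: fin_gset_finite[OF X] fin_gset_finite[OF Y] act_in[OF X] act_in[OF Y] act_one[OF X] act_one[OF Y]
        act_mult[OF X] act_mult[OF Y])
  obtain C :: "('a, 'u) gset" and h where C: "fin_gset G C" and "gset_iso G C ?S h"
    using gset_iso_exists[OF assms(1) S] by blast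
  then obtain k where k: "gset_iso G ?S C k"
    using gset_iso_inverse[OF C S] by blast
  then have k': "k \<in> gmaps G ?S C" "inj_on k (pts X <+> pts Y)" "pts C = k ` (pts X <+> pts Y)"
    by (auto simp: gset_iso_def bij_betw_def)
  have "disjoint_union G X Y C (\<lambda>x\<in>pts X. k (Inl x)) (\<lambda>y\<in>pts Y. k (Inr y))"
    unfolding disjoint_union_def
  proof (intro conjI X Y C)
    show "(\<lambda>x\<in>pts X. k (Inl x)) \<in> gmaps G X C"
      using gmaps_in[OF k'(1)] gmaps_act[OF k'(1), of _ "Inl _"]
      by (intro restrict_gmaps) (auto simp: act_in[OF X])
    show "(\<lambda>x\<in>pts Y. k (Inr x)) \<in> gmaps G Y C"
      using gmaps_in[OF k'(1)] gmaps_act[OF k'(1), of _ "Inr _"]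
      by (intro restrict_gmaps) (auto simp: act_in[OF Y])
    show "inj_on (\<lambda>x\<in>pts X. k (Inl x)) (pts X)" "inj_on (\<lambda>y\<in>pts Y. k (Inr y)) (pts Y)"
      using inj_onD[OF k'(2)] by (fastforce intro!: inj_onI)+
    show "(\<lambda>x\<in>pts X. k (Inl x)) ` pts X \<inter> (\<lambda>y\<in>pts Y. k (Inr y)) ` pts Y = {}"
      using inj_onD[OF k'(2)] by fastforce
    show "pts C = (\<lambda>x\<in>pts X. k (Inl x)) ` pts X \<union> (\<lambda>y\<in>pts Y. k (Inr y)) ` pts Y"
      by (simp add: k'(3) Plus_def image_Un image_image)
  qed
  then show ?thesis using that by blast
qed

text \<open>The underlying sets decide: it suffices that the points of \<open>X'\<close> correspond
  to the compatible pairs of points of \<open>X\<close> and \<open>Y'\<close>.\<close>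

lemma is_pullbackI:
  fixes X' Y' X Y :: "('a, 'u) gset"
  assumes fin: "fin_gset G X'" "fin_gset G Y'" "fin_gset G X" "fin_gset G Y"
    and maps: "f' \<in> gmaps G X' Y'" "\<xi> \<in> gmaps G X' X" "\<eta> \<in> gmaps G Y' Y" "f \<in> gmaps G X Y"
    and comm: "\<And>z. z \<in> pts X' \<Longrightarrow> f (\<xi> z) = \<eta> (f' z)"
    and inj: "\<And>z w. z \<in> pts X' \<Longrightarrow> w \<in> pts X' \<Longrightarrow> \<xi> z = \<xi> w \<Longrightarrow> f' z = f' w \<Longrightarrow> z = w"
    and surj: "\<And>x y. x \<in> pts X \<Longrightarrow> y \<in> pts Y' \<Longrightarrow> f x = \<eta> y \<Longrightarrow> \<exists>z\<in>pts X'. \<xi> z = x \<and> f' z = y"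
  shows "is_pullback G X' Y' X Y f' \<xi> \<eta> f"
proof -
  have "\<exists>!t. t \<in> gmaps G W X' \<and> gcomp W \<xi> t = u \<and> gcomp W f' t = v"
    if W: "fin_gset G W" and u: "u \<in> gmaps G W X" and v: "v \<in> gmaps G W Y'"
      and e: "gcomp W f u = gcomp W \<eta> v" for W :: "('a, 'u) gset" and u v
  proof -
    have e': "f (u w) = \<eta> (v w)" if "w \<in> pts W" for w
      using fun_cong[OF e, of w] that by (simp add: compose_def)
    have "\<forall>w\<in>pts W. \<exists>z. z \<in> pts X' \<and> \<xi> z = u w \<and> f' z = v w"
      using surj e' gmaps_in[OF u] gmaps_in[OF v] by meson
    then obtain t where t: "\<And>w. w \<in> pts W \<Longrightarrow> t w \<in> pts X' \<and> \<xi> (t w) = u w \<and> f' (t w) = v w"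
      by metis
    have "(\<lambda>w\<in>pts W. t w) \<in> gmaps G W X'"
    proof (rule restrict_gmaps)
      fix g w assume g: "g \<in> carrier G" and w: "w \<in> pts W"
      have tw: "t w \<in> pts X'" "\<xi> (t w) = u w" "f' (t w) = v w" using t[OF w] by auto
      show "t (act W g w) = act X' g (t w)"
        \<comment> \<open>Both sides have the same images under \<open>\<xi>\<close> and
          \<open>f'\<close>, so joint injectivity makes the pointwise choice \<open>t\<close>
          equivariant.\<close>
        by (rule inj)
          (use t[OF act_in[OF W g w]] act_in[OF fin(1) g tw(1)] gmaps_act[OF maps(2) g tw(1)] tw
            gmaps_act[OF maps(1) g tw(1)] gmaps_act[OF u g w] gmaps_act[OF v g w] in auto)
    qed (use t W in \<open>auto simp: act_in\<close>)
    moreover have "s = t" if "s \<in> gmaps G W X'" "t \<in> gmaps G W X'" "gcomp W \<xi> s = u" "gcomp W f' s = v"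
      "gcomp W \<xi> t = u" "gcomp W f' t = v" for s t
    proof (rule gmaps_eqI[OF that(1,2)])
      fix w assume w: "w \<in> pts W"
      show "s w = t w"
        by (rule inj) (use that w in \<open>auto simp: gcomp_eq_iff[OF u] gcomp_eq_iff[OF v] gmaps_in\<close>)
    qed
    moreover have "gcomp W \<xi> (\<lambda>w\<in>pts W. t w) = u" "gcomp W f' (\<lambda>w\<in>pts W. t w) = v"
      using t by (simp_all add: gcomp_eq_iff[OF u] gcomp_eq_iff[OF v])
    ultimately show ?thesis by blast
  qed
  moreover have "gcomp X' f \<xi> = gcomp X' \<eta> f'"
    using comm by (auto simp: compose_def)
  ultimately show ?thesis using fin maps unfolding is_pullback_def by blast
qed

lemma fin_gset_fib_prod:
  assumes X: "fin_gset G X" and B: "fin_gset G B" and f: "f \<in> gmaps G X Y" and q: "q \<in> gmaps G B Y"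
  shows "fin_gset G (fib_prod X B f q)"
proof (rule fin_gsetI)
  have "fib_prod_pts X B f q \<subseteq> pts X \<times> pts B"
    by (auto simp: fib_prod_pts_def)
  then show "finite (pts (fib_prod X B f q))"
    using fin_gset_finite[OF X] fin_gset_finite[OF B]
    by (auto simp: fib_prod_def intro: finite_subset)
qed (auto simp: fib_prod_def fib_prod_pts_def act_in[OF X] act_in[OF B] gmaps_act[OF f] gmaps_act[OF q]
    act_one[OF X] act_one[OF B] act_mult[OF X] act_mult[OF B])

lemma pullback_exists:
  fixes X Y Y' :: "('a, 'u) gset"
  assumes inf: "infinite (UNIV :: 'u set)" and Y': "fin_gset G Y'" and X: "fin_gset G X" and Y: "fin_gset G Y"
    and \<eta>: "\<eta> \<in> gmaps G Y' Y" and f: "f \<in> gmaps G X Y"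
  obtains X' :: "('a, 'u) gset" and f' \<xi> where "is_pullback G X' Y' X Y f' \<xi> \<eta> f"
proof -
  let ?F = "fib_prod X Y' f \<eta>"
  have F: "fin_gset G ?F" by (rule fin_gset_fib_prod[OF X Y' f \<eta>])
  obtain X' :: "('a, 'u) gset" and h where X': "fin_gset G X'" and h: "gset_iso G X' ?F h"
    using gset_iso_exists[OF inf F] by blast
  then have hm: "h \<in> gmaps G X' ?F" and hb: "bij_betw h (pts X') (pts ?F)"
    by (auto simp: gset_iso_def)
  have hp: "fst (h z) \<in> pts X" "snd (h z) \<in> pts Y'" "f (fst (h z)) = \<eta> (snd (h z))"
    if "z \<in> pts X'" for z
    using gmaps_in[OF hm that] by (auto simp: fib_prod_def fib_prod_pts_def)
  have ha: "h (act X' g z) = (act X g (fst (h z)), act Y' g (snd (h z)))"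
    if "z \<in> pts X'" "g \<in> carrier G" for g z
    using gmaps_act[OF hm that(2,1)] gmaps_in[OF hm that(1)]
    by (auto simp: fib_prod_def split: prod.splits)
  have "is_pullback G X' Y' X Y (\<lambda>z\<in>pts X'. snd (h z)) (\<lambda>z\<in>pts X'. fst (h z)) \<eta> f"
  proof (rule is_pullbackI[OF X' Y' X Y _ _ \<eta> f])
    fix x y assume "x \<in> pts X" "y \<in> pts Y'" "f x = \<eta> y"
    then have "(x, y) \<in> h ` pts X'"
      using hb by (auto simp: bij_betw_def fib_prod_def fib_prod_pts_def)
    then obtain z where "z \<in> pts X'" "(x, y) = h z" by auto
    then show "\<exists>z\<in>pts X'. (\<lambda>z\<in>pts X'. fst (h z)) z = x \<and> (\<lambda>z\<in>pts X'. snd (h z)) z = y"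
      by (intro bexI[of _ z]) (auto dest: sym)
  next
    fix z w assume "z \<in> pts X'" "w \<in> pts X'" "(\<lambda>z\<in>pts X'. fst (h z)) z = (\<lambda>z\<in>pts X'. fst (h z)) w"
      "(\<lambda>z\<in>pts X'. snd (h z)) z = (\<lambda>z\<in>pts X'. snd (h z)) w"
    then show "z = w" using hb by (simp add: bij_betw_def inj_on_def prod_eq_iff)
  qed (use hp in \<open>auto intro!: restrict_gmaps simp: ha act_in[OF X']\<close>)
  then show ?thesis using that by blast
qed

end

section \<open>Semi-Mackey functors\<close>

text \<open>Inverses are not assumed, so that the same results apply to transfers and to
  norms.\<close>

locale semi_mackey_functor = group G for G :: "('g, 'm) monoid_scheme" (structure) +
  fixes V :: "('g, 'u, 'a) gobj" and R S :: "('g, 'u, 'a) gmor"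
  assumes inf_univ: "infinite (UNIV :: 'u set)"
    and semi_mackey: "semi_mackey G V R S"
begin

lemma R_closed:
  assumes "fin_gset G X" "fin_gset G Y" "f \<in> gmaps G X Y" "a \<in> V Y"
  shows "R X Y f a \<in> V X"
proof -
  have "R X Y f \<in> V Y \<rightarrow> V X"
    using semi_mackey assms(1-3) by (simp add: semi_mackey_def contra_functor_def)
  then show ?thesis using assms(4) by (rule funcset_mem)
qed

lemma S_closed:
  assumes "fin_gset G X" "fin_gset G Y" "f \<in> gmaps G X Y" "a \<in> V X"
  shows "S X Y f a \<in> V Y"
proof -
  have "S X Y f \<in> V X \<rightarrow> V Y"
    using semi_mackey assms(1-3) by (simp add: semi_mackey_def co_functor_def)
  then show ?thesis using assms(4) by (rule funcset_mem)
qed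

lemma R_id:
  assumes "fin_gset G X" "a \<in> V X" "m \<in> gmaps G X X" "\<And>x. x \<in> pts X \<Longrightarrow> m x = x"
  shows "R X X m a = a"
proof -
  have "m = gid X" by (rule gmaps_eqI) (use assms id_gmaps in auto)
  then show ?thesis using semi_mackey assms unfolding semi_mackey_def contra_functor_def by blast
qed

lemma S_id:
  assumes "fin_gset G X" "a \<in> V X" "m \<in> gmaps G X X" "\<And>x. x \<in> pts X \<Longrightarrow> m x = x"
  shows "S X X m a = a"
proof -
  have "m = gid X" by (rule gmaps_eqI) (use assms id_gmaps in auto)
  then show ?thesis using semi_mackey assms unfolding semi_mackey_def co_functor_def by blast
qed

lemma R_gid: "fin_gset G X \<Longrightarrow> a \<in> V X \<Longrightarrow> R X X (gid X) a = a"
  by (rule R_id) (simp_all add: id_gmaps)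

lemma S_gid: "fin_gset G X \<Longrightarrow> a \<in> V X \<Longrightarrow> S X X (gid X) a = a"
  by (rule S_id) (simp_all add: id_gmaps)

text \<open>The composite enters as any \<open>m\<close> with the right values on points, so that
  maps built in different ways can be compared without matching the form of
  \<open>compose\<close>.\<close>

lemma R_comp:
  assumes "fin_gset G X" "fin_gset G Y" "fin_gset G Z" "f \<in> gmaps G X Y" "k \<in> gmaps G Y Z"
    "m \<in> gmaps G X Z" "\<And>x. x \<in> pts X \<Longrightarrow> m x = k (f x)" "a \<in> V Z"
  shows "R X Y f (R Y Z k a) = R X Z m a"
proof -
  have "gcomp X k f = m" using assms by (simp add: gcomp_eq_iff)
  moreover have "\<forall>X Y Z f k. fin_gset G X \<and> fin_gset G Y \<and> fin_gset G Z \<and> f \<in> gmaps G X Y \<and> k \<in> gmaps G Y Z \<longrightarrow>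
      (\<forall>a\<in>V Z. R X Z (gcomp X k f) a = R X Y f (R Y Z k a))"
    using semi_mackey unfolding semi_mackey_def contra_functor_def by (elim conjE)
  from this[rule_format, OF conjI[OF assms(1) conjI[OF assms(2) conjI[OF assms(3) conjI[OF assms(4,5)]]]] assms(8)]
  have "R X Z (gcomp X k f) a = R X Y f (R Y Z k a)" .
  ultimately show ?thesis by simp
qed

lemma S_comp:
  assumes "fin_gset G X" "fin_gset G Y" "fin_gset G Z" "f \<in> gmaps G X Y" "k \<in> gmaps G Y Z"
    "m \<in> gmaps G X Z" "\<And>x. x \<in> pts X \<Longrightarrow> m x = k (f x)" "a \<in> V X"
  shows "S Y Z k (S X Y f a) = S X Z m a"
proof -
  have "gcomp X k f = m" using assms by (simp add: gcomp_eq_iff)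
  moreover have "\<forall>X Y Z f k. fin_gset G X \<and> fin_gset G Y \<and> fin_gset G Z \<and> f \<in> gmaps G X Y \<and> k \<in> gmaps G Y Z \<longrightarrow>
      (\<forall>a\<in>V X. S X Z (gcomp X k f) a = S Y Z k (S X Y f a))"
    using semi_mackey unfolding semi_mackey_def co_functor_def by (elim conjE)
  from this[rule_format, OF conjI[OF assms(1) conjI[OF assms(2) conjI[OF assms(3) conjI[OF assms(4,5)]]]] assms(8)]
  have "S X Z (gcomp X k f) a = S Y Z k (S X Y f a)" .
  ultimately show ?thesis by simp
qed

lemma V_empty_ex1: "fin_gset G X \<Longrightarrow> pts X = {} \<Longrightarrow> \<exists>!a. a \<in> V X"
  using semi_mackey unfolding semi_mackey_def by blast

section \<open>Additivity, base change and the folding operation\<close>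

lemma V_empty_eq: "fin_gset G X \<Longrightarrow> pts X = {} \<Longrightarrow> a \<in> V X \<Longrightarrow> b \<in> V X \<Longrightarrow> a = b"
  using V_empty_ex1 by blast

lemma coproduct_bij:
  "is_coproduct G X Y C i j \<Longrightarrow> bij_betw (\<lambda>c. (R X C i c, R Y C j c)) (V C) (V X \<times> V Y)"
  using semi_mackey unfolding semi_mackey_def by blast

lemma coproduct_eqI:
  assumes "is_coproduct G X Y C i j" "a \<in> V C" "b \<in> V C"
    "R X C i a = R X C i b" "R Y C j a = R Y C j b"
  shows "a = b"
  using coproduct_bij[OF assms(1)] assms(2-) by (auto simp: bij_betw_def inj_on_def)

lemma coproduct_glue:
  assumes "is_coproduct G X Y C i j" "a \<in> V X" "b \<in> V Y"
  obtains c where "c \<in> V C" "R X C i c = a" "R Y C j c = b"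
proof -
  have "(a, b) \<in> (\<lambda>c. (R X C i c, R Y C j c)) ` V C"
    using coproduct_bij[OF assms(1)] assms(2-) by (auto simp: bij_betw_def)
  then show ?thesis using that by auto
qed

lemma base_change:
  "is_pullback G X' Y' X Y f' \<xi> \<eta> f \<Longrightarrow> a \<in> V X \<Longrightarrow>
    R Y' Y \<eta> (S X Y f a) = S X' Y' f' (R X' X \<xi> a)"
  using semi_mackey unfolding semi_mackey_def by blast

text \<open>The square formed by \<open>t\<close>, its inverse \<open>k\<close> and two identities
  is cartesian, so base change identifies the covariant map of \<open>t\<close> with the
  contravariant map of \<open>k\<close>. This later reduces transfers and norms along automorphisms
  of the free orbit to restrictions.\<close>

lemma S_iso:
  assumes X: "fin_gset G X" and Y: "fin_gset G Y" and t: "t \<in> gmaps G X Y" and k: "k \<in> gmaps G Y X"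
    and kt: "\<And>x. x \<in> pts X \<Longrightarrow> k (t x) = x" and tk: "\<And>y. y \<in> pts Y \<Longrightarrow> t (k y) = y"
    and a: "a \<in> V X"
  shows "S X Y t a = R Y X k a"
proof -
  have "is_pullback G Y Y X Y (gid Y) k (gid Y) t"
    by (rule is_pullbackI) (use assms id_gmaps[OF Y] gmaps_in[OF k] in auto)
  from base_change[OF this a] show ?thesis
    by (simp add: R_id[OF Y] S_id[OF Y] S_closed R_closed assms id_gmaps[OF Y])
qed

lemma coproduct_ex1_map:
  fixes X Y C W :: "('g, 'u) gset"
  assumes C: "is_coproduct G X Y C i j" and W: "fin_gset G W"
    and u: "u \<in> gmaps G X W" and v: "v \<in> gmaps G Y W"
  shows "\<exists>!t. t \<in> gmaps G C W \<and> gcomp X t i = u \<and> gcomp Y t j = v"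
proof -
  note * = C[unfolded is_coproduct_def, THEN conjunct2, THEN conjunct2, THEN conjunct2, THEN conjunct2, THEN conjunct2]
  from *[rule_format, OF conjI[OF W conjI[OF u v]]] show ?thesis .
qed

lemma coproduct_map:
  fixes X Y C W :: "('g, 'u) gset"
  assumes C: "is_coproduct G X Y C i j" and W: "fin_gset G W"
    and u: "u \<in> gmaps G X W" and v: "v \<in> gmaps G Y W"
  obtains t where "t \<in> gmaps G C W" "\<And>x. x \<in> pts X \<Longrightarrow> t (i x) = u x"
    "\<And>y. y \<in> pts Y \<Longrightarrow> t (j y) = v y"
proof -
  obtain t where "t \<in> gmaps G C W" "gcomp X t i = u" "gcomp Y t j = v"
    using coproduct_ex1_map[OF C W u v] by blast
  then show ?thesis using that gcomp_eq_iff[OF u] gcomp_eq_iff[OF v] by blast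
qed

lemma coproduct_map_eqI:
  fixes X Y C W :: "('g, 'u) gset"
  assumes C: "is_coproduct G X Y C i j" and W: "fin_gset G W"
    and s: "s \<in> gmaps G C W" and t: "t \<in> gmaps G C W"
    and i: "\<And>x. x \<in> pts X \<Longrightarrow> s (i x) = t (i x)" and j: "\<And>y. y \<in> pts Y \<Longrightarrow> s (j y) = t (j y)"
  shows "s = t"
proof -
  have m: "fin_gset G X" "fin_gset G Y" "i \<in> gmaps G X C" "j \<in> gmaps G Y C"
    using C by (auto simp: is_coproduct_def)
  have g: "gcomp X t i \<in> gmaps G X W" "gcomp Y t j \<in> gmaps G Y W"
    unfolding compose_def by (rule comp_gmaps[OF m(1,3) t], rule comp_gmaps[OF m(2,4) t])
  moreover have "gcomp X s i = gcomp X t i" "gcomp Y s j = gcomp Y t j"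
    using i j by (auto simp: compose_def)
  ultimately show ?thesis using coproduct_ex1_map[OF C W g] s t by blast
qed

text \<open>Two coproducts of the same summands are linked by inverse maps \<open>t\<close> and
  \<open>k\<close>, and \<open>S_iso\<close> moves \<open>c\<close> to \<open>c'\<close>. This is
  what makes the \<open>THE\<close> in \<open>fold_op\<close> well defined.\<close>

lemma coproduct_S_unique:
  assumes C: "is_coproduct G X Y C i j" and C': "is_coproduct G X Y C' i' j'"
    and Z: "fin_gset G Z" and n: "n \<in> gmaps G C Z" and n': "n' \<in> gmaps G C' Z"
    and ni: "\<And>x. x \<in> pts X \<Longrightarrow> n (i x) = n' (i' x)" and nj: "\<And>y. y \<in> pts Y \<Longrightarrow> n (j y) = n' (j' y)"
    and c: "c \<in> V C" and c': "c' \<in> V C'"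
    and ci: "R X C i c = R X C' i' c'" and cj: "R Y C j c = R Y C' j' c'"
  shows "S C Z n c = S C' Z n' c'"
proof -
  have fin: "fin_gset G X" "fin_gset G Y" "fin_gset G C" "fin_gset G C'"
    and m: "i \<in> gmaps G X C" "j \<in> gmaps G Y C" "i' \<in> gmaps G X C'" "j' \<in> gmaps G Y C'"
    using C C' by (auto simp: is_coproduct_def)
  obtain t where t: "t \<in> gmaps G C C'" and ti: "\<And>x. x \<in> pts X \<Longrightarrow> t (i x) = i' x"
    and tj: "\<And>y. y \<in> pts Y \<Longrightarrow> t (j y) = j' y"
    using coproduct_map[OF C fin(4) m(3,4)] by blast
  obtain k where k: "k \<in> gmaps G C' C" and ki: "\<And>x. x \<in> pts X \<Longrightarrow> k (i' x) = i x"
    and kj: "\<And>y. y \<in> pts Y \<Longrightarrow> k (j' y) = j y"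
    using coproduct_map[OF C' fin(3) m(1,2)] by blast
  have "(\<lambda>z\<in>pts C. k (t z)) = gid C"
    by (rule coproduct_map_eqI[OF C fin(3) comp_gmaps[OF fin(3) t k] id_gmaps[OF fin(3)]])
      (simp_all add: ti tj ki kj gmaps_in[OF m(1)] gmaps_in[OF m(2)])
  then have kt: "k (t z) = z" if "z \<in> pts C" for z using that by (metis restrict_apply')
  have "(\<lambda>z\<in>pts C'. t (k z)) = gid C'"
    by (rule coproduct_map_eqI[OF C' fin(4) comp_gmaps[OF fin(4) k t] id_gmaps[OF fin(4)]])
      (simp_all add: ti tj ki kj gmaps_in[OF m(3)] gmaps_in[OF m(4)])
  then have tk: "t (k z) = z" if "z \<in> pts C'" for z using that by (metis restrict_apply')
  have Rk: "R C' C k c = c'"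
  proof (rule coproduct_eqI[OF C'])
    show "R X C' i' (R C' C k c) = R X C' i' c'"
      using ci by (subst R_comp[where m = i]) (use fin m k ki c in auto)
    show "R Y C' j' (R C' C k c) = R Y C' j' c'"
      using cj by (subst R_comp[where m = j]) (use fin m k kj c in auto)
  qed (use R_closed fin k c c' in auto)
  have "(\<lambda>z\<in>pts C. n' (t z)) = n"
    by (rule coproduct_map_eqI[OF C Z comp_gmaps[OF fin(3) t n'] n])
      (simp_all add: ti tj ni nj gmaps_in[OF m(1)] gmaps_in[OF m(2)])
  then have nt: "n z = n' (t z)" if "z \<in> pts C" for z using that by (metis restrict_apply')
  have "S C Z n c = S C' Z n' (S C C' t c)"
    by (rule S_comp[symmetric]) (use fin Z t n n' nt c in auto)
  also have "S C C' t c = c'"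
    using S_iso[OF fin(3,4) t k kt tk c] Rk by simp
  finally show ?thesis .
qed

lemma fold_op_eq:
  assumes C: "is_coproduct G X X C i j" and n: "n \<in> gmaps G C X"
    and ni: "\<And>x. x \<in> pts X \<Longrightarrow> n (i x) = x" "\<And>x. x \<in> pts X \<Longrightarrow> n (j x) = x" and c: "c \<in> V C"
  shows "fold_op G V R S X (R X C i c) (R X C j c) = S C X n c"
proof -
  have X: "fin_gset G X" using C by (auto simp: is_coproduct_def)
  note * = gcomp_eq_iff[OF id_gmaps[OF X]]
  have n': "gcomp X n i = gid X" "gcomp X n j = gid X" using ni by (auto simp: *)
  show ?thesis
    unfolding fold_op_def
  proof (rule the_equality)
    fix s
    assume "\<exists>C' i' j' n' c'. is_coproduct G X X C' i' j' \<and>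
        n' \<in> gmaps G C' X \<and> gcomp X n' i' = gid X \<and> gcomp X n' j' = gid X \<and>
        c' \<in> V C' \<and> R X C' i' c' = R X C i c \<and> R X C' j' c' = R X C j c \<and> s = S C' X n' c'"
    then obtain C' i' j' n' c' where *: "is_coproduct G X X C' i' j'" "n' \<in> gmaps G C' X"
      "gcomp X n' i' = gid X" "gcomp X n' j' = gid X" "c' \<in> V C'" "R X C' i' c' = R X C i c"
      "R X C' j' c' = R X C j c" "s = S C' X n' c'"
      by blast
    show "s = S C X n c"
      unfolding *(8)
      by (rule coproduct_S_unique[OF *(1) C X *(2) n _ _ *(5) c *(6,7)])
        (use *(3,4) ni in \<open>simp_all add: gcomp_eq_iff[OF id_gmaps[OF X]]\<close>)
  qed (use assms n' in blast)
qed

lemma fold_op_obtain: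
  assumes X: "fin_gset G X" and a: "a \<in> V X" and b: "b \<in> V X"
  obtains C i j n c where "disjoint_union G X X C i j" "n \<in> gmaps G C X"
    "\<And>x. x \<in> pts X \<Longrightarrow> n (i x) = x" "\<And>x. x \<in> pts X \<Longrightarrow> n (j x) = x"
    "c \<in> V C" "R X C i c = a" "R X C j c = b" "fold_op G V R S X a b = S C X n c"
proof -
  obtain C :: "('g, 'u) gset" and i j where du: "disjoint_union G X X C i j"
    using disjoint_union_exists[OF inf_univ X X] by blast
  obtain n where n: "n \<in> gmaps G C X" "\<And>x. x \<in> pts X \<Longrightarrow> n (i x) = gid X x"
    "\<And>x. x \<in> pts X \<Longrightarrow> n (j x) = gid X x"
    using disjoint_union_map[OF du id_gmaps[OF X] id_gmaps[OF X]] by blast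
  note cop = disjoint_union_is_coproduct[OF du]
  obtain c where c: "c \<in> V C" "R X C i c = a" "R X C j c = b"
    using coproduct_glue[OF cop a b] by blast
  show ?thesis
    by (rule that[OF du n(1) _ _ c]) (use n fold_op_eq[OF cop n(1) _ _ c(1)] c in auto)
qed

lemma fold_op_closed:
  assumes X: "fin_gset G X" and a: "a \<in> V X" and b: "b \<in> V X"
  shows "fold_op G V R S X a b \<in> V X"
proof (rule fold_op_obtain[OF X a b])
  fix C i j n c assume "disjoint_union G X X C i j" "n \<in> gmaps G C X" "c \<in> V C"
    "fold_op G V R S X a b = S C X n c"
  then show ?thesis using S_closed X disjoint_unionD(3) by metis
qed

text \<open>Any two empty G-sets are linked by a map, and the value at each is a single element, so
  the choices hidden in \<open>fold_unit\<close> do not matter.\<close>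

lemma fold_unit_eq:
  assumes X: "fin_gset G X" and E: "fin_gset G E" "pts E = {}" and u: "u \<in> gmaps G E X"
    and c: "c \<in> V E"
  shows "fold_unit G V S X = S E X u c"
  unfolding fold_unit_def
proof (rule the_equality)
  fix s assume "\<exists>E u c. fin_gset G E \<and> pts E = {} \<and> u \<in> gmaps G E X \<and> c \<in> V E \<and> s = S E X u c"
  then obtain E' u' c' where E': "fin_gset G E'" "pts E' = {}" "u' \<in> gmaps G E' X" "c' \<in> V E'"
    and s: "s = S E' X u' c'" by blast
  let ?m = "\<lambda>_. undefined"
  have m: "?m \<in> gmaps G E' E" by (rule empty_gmaps[OF E'(2)])
  have "s = S E X u (S E' E ?m c')"
    unfolding s by (rule S_comp[symmetric]) (use X E E' u m in auto)
  also have "S E' E ?m c' = c"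
    by (rule V_empty_eq[OF E]) (use S_closed E E' m c in auto)
  finally show "s = S E X u c" .
qed (use assms in blast)

lemma empty_gset_obtain:
  obtains E :: "('g, 'u) gset" and c where "fin_gset G E" "pts E = {}" "c \<in> V E"
proof -
  define E :: "('g, 'u) gset" where "E = \<lparr>pts = {}, act = \<lambda>_ _. undefined\<rparr>"
  have E: "fin_gset G E" by (rule fin_gsetI) (auto simp: E_def)
  have p: "pts E = {}" by (simp add: E_def)
  show ?thesis using that[OF E p] V_empty_ex1[OF E p] by blast
qed

lemma fold_unit_closed: "fin_gset G X \<Longrightarrow> fold_unit G V S X \<in> V X"
  by (rule empty_gset_obtain) (metis S_closed empty_gmaps fold_unit_eq)

lemma S_fold_unit:
  assumes X: "fin_gset G X" and Y: "fin_gset G Y" and f: "f \<in> gmaps G X Y"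
  shows "S X Y f (fold_unit G V S X) = fold_unit G V S Y"
proof (rule empty_gset_obtain)
  fix E :: "('g, 'u) gset" and c assume E: "fin_gset G E" "pts E = {}" and c: "c \<in> V E"
  let ?m = "\<lambda>_. undefined"
  have m: "?m \<in> gmaps G E Z" for Z :: "('g, 'u) gset" by (rule empty_gmaps[OF E(2)])
  show ?thesis
    unfolding fold_unit_eq[OF X E m c] fold_unit_eq[OF Y E m c]
    by (rule S_comp) (use X Y E f m c in auto)
qed

text \<open>Pulling an empty G-set back along \<open>f\<close> gives an empty one again; base change
  along this square moves the unit.\<close>

lemma R_fold_unit:
  assumes X: "fin_gset G X" and Y: "fin_gset G Y" and f: "f \<in> gmaps G X Y"
  shows "R X Y f (fold_unit G V S Y) = fold_unit G V S X"
proof (rule empty_gset_obtain)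
  fix E :: "('g, 'u) gset" and c assume E: "fin_gset G E" "pts E = {}" and c: "c \<in> V E"
  let ?m = "\<lambda>_. undefined"
  have m: "?m \<in> gmaps G E Z" for Z :: "('g, 'u) gset" by (rule empty_gmaps[OF E(2)])
  have "is_pullback G E X E Y ?m ?m f ?m"
    by (rule is_pullbackI) (use X Y E f m in auto)
  from base_change[OF this c] show ?thesis
    using fold_unit_eq[OF X E m] fold_unit_eq[OF Y E m] R_closed[OF E(1) E(1) m] c by metis
qed

text \<open>Factor \<open>f\<close> through \<open>Z \<amalg> Z\<close>, sending each summand to its own copy, and fold.\<close>

lemma S_disjoint_union:
  assumes du: "disjoint_union G X Y C i j" and Z: "fin_gset G Z" and f: "f \<in> gmaps G C Z"
    and fX: "fX \<in> gmaps G X Z" "\<And>x. x \<in> pts X \<Longrightarrow> f (i x) = fX x"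
    and fY: "fY \<in> gmaps G Y Z" "\<And>y. y \<in> pts Y \<Longrightarrow> f (j y) = fY y"
    and c: "c \<in> V C"
  shows "S C Z f c = fold_op G V R S Z (S X Z fX (R X C i c)) (S Y Z fY (R Y C j c))"
proof -
  note d = disjoint_unionD[OF du]
  obtain D :: "('g, 'u) gset" and k1 k2 where du': "disjoint_union G Z Z D k1 k2"
    using disjoint_union_exists[OF inf_univ Z Z] by blast
  note d' = disjoint_unionD[OF du']
  note e' = disjoint_union_eqs[OF du']
  obtain n where n: "n \<in> gmaps G D Z" "\<And>x. x \<in> pts Z \<Longrightarrow> n (k1 x) = gid Z x"
    "\<And>x. x \<in> pts Z \<Longrightarrow> n (k2 x) = gid Z x"
    using disjoint_union_map[OF du' id_gmaps[OF Z] id_gmaps[OF Z]] by blast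
  obtain h where h: "h \<in> gmaps G C D" "\<And>x. x \<in> pts X \<Longrightarrow> h (i x) = k1 (fX x)"
    "\<And>y. y \<in> pts Y \<Longrightarrow> h (j y) = k2 (fY y)"
    using disjoint_union_map[OF du comp_gmaps[OF d(1) fX(1) d'(4)] comp_gmaps[OF d(2) fY(1) d'(5)]]
    by auto
  have nh: "f z = n (h z)" if "z \<in> pts C" for z
    using du that
    by (cases rule: disjoint_union_cases) (simp_all add: fX fY h n gmaps_in[OF fX(1)] gmaps_in[OF fY(1)])
  \<comment> \<open>\<open>h\<close> reaches the copy \<open>k1\<close> of \<open>Z\<close> only
    from the summand \<open>X\<close>, so base change computes the first coordinate of
    \<open>S C D h c\<close> from the restriction of \<open>c\<close> to \<open>X\<close>.\<close>
  have "is_pullback G X Z C D fX i k1 h"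
  proof (rule is_pullbackI)
    fix z y assume "z \<in> pts C" and y: "y \<in> pts Z" "h z = k1 y"
    from du this(1) show "\<exists>x\<in>pts X. i x = z \<and> fX x = y"
      by (cases rule: disjoint_union_cases)
        (use y in \<open>auto simp: h gmaps_in[OF fX(1)] gmaps_in[OF fY(1)] e'\<close>)
  qed (use d d' fX h Z disjoint_union_eqs[OF du] in auto)
  from base_change[OF this c] have 1: "R Z D k1 (S C D h c) = S X Z fX (R X C i c)" .
  have "is_pullback G Y Z C D fY j k2 h"
  proof (rule is_pullbackI)
    fix z y assume "z \<in> pts C" and y: "y \<in> pts Z" "h z = k2 y"
    from du this(1) show "\<exists>x\<in>pts Y. j x = z \<and> fY x = y"
      by (cases rule: disjoint_union_cases)
        (use y in \<open>auto simp: h gmaps_in[OF fX(1)] gmaps_in[OF fY(1)] e'\<close>)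
  qed (use d d' fY h Z disjoint_union_eqs[OF du] in auto)
  from base_change[OF this c] have 2: "R Z D k2 (S C D h c) = S Y Z fY (R Y C j c)" .
  have "S C Z f c = S D Z n (S C D h c)"
    by (rule S_comp[symmetric]) (use d d' Z h n f nh c in auto)
  also have "\<dots> = fold_op G V R S Z (R Z D k1 (S C D h c)) (R Z D k2 (S C D h c))"
    by (rule fold_op_eq[symmetric])
      (use disjoint_union_is_coproduct[OF du'] n S_closed[OF d(3) d'(3) h(1) c] in auto)
  finally show ?thesis by (simp add: 1 2)
qed

lemma S_fold_map:
  assumes du: "disjoint_union G X X C i j" and n: "n \<in> gmaps G C X"
    "\<And>x. x \<in> pts X \<Longrightarrow> n (i x) = x" "\<And>x. x \<in> pts X \<Longrightarrow> n (j x) = x" and c: "c \<in> V C"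
  shows "S C X n c = fold_op G V R S X (R X C i c) (R X C j c)"
  using fold_op_eq[OF disjoint_union_is_coproduct[OF du] n c] by simp

section \<open>The commutative monoid of values and its restrictions\<close>

lemma fold_op_comm:
  assumes X: "fin_gset G X" and a: "a \<in> V X" and b: "b \<in> V X"
  shows "fold_op G V R S X a b = fold_op G V R S X b a"
proof (rule fold_op_obtain[OF X a b])
  fix C i j n c assume *: "disjoint_union G X X C i j" "n \<in> gmaps G C X"
    "\<And>x. x \<in> pts X \<Longrightarrow> n (i x) = x" "\<And>x. x \<in> pts X \<Longrightarrow> n (j x) = x"
    "c \<in> V C" "R X C i c = a" "R X C j c = b" "fold_op G V R S X a b = S C X n c"
  show ?thesis
    using S_fold_map[OF disjoint_union_swap[OF *(1)] *(2,4,3,5)] * by simp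
qed

text \<open>\<open>X\<close> is also the disjoint union of itself and an empty G-set; splitting the
  identity map along this decomposition gives the law.\<close>

lemma fold_op_unit:
  assumes X: "fin_gset G X" and a: "a \<in> V X"
  shows "fold_op G V R S X a (fold_unit G V S X) = a"
proof (rule empty_gset_obtain)
  fix E :: "('g, 'u) gset" and c assume E: "fin_gset G E" "pts E = {}" and c: "c \<in> V E"
  let ?m = "\<lambda>_. undefined"
  have m: "?m \<in> gmaps G E X" by (rule empty_gmaps[OF E(2)])
  note id = id_gmaps[OF X]
  have du: "disjoint_union G X E X (gid X) ?m"
    unfolding disjoint_union_def using X E m id by (auto simp: inj_on_def)
  from S_disjoint_union[OF du X id id _ m _ a]
  have "S X X (gid X) a = fold_op G V R S X (S X X (gid X) (R X X (gid X) a)) (S E X ?m (R E X ?m a))"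
    using E by auto
  then show ?thesis
    using fold_unit_eq[OF X E m R_closed[OF E(1) X m a]] S_id[OF X a id] R_id[OF X a id] by simp
qed

text \<open>Both sides compute \<open>S\<close> of the threefold folding map \<open>f\<close> on
  three copies of \<open>X\<close>. Splitting \<open>C\<close> as two copies and a third gives the
  left bracketing, splitting it as the first copy and the remaining two gives the right one.\<close>

lemma fold_op_assoc:
  assumes X: "fin_gset G X" and a: "a \<in> V X" "b \<in> V X" "b' \<in> V X"
  shows "fold_op G V R S X (fold_op G V R S X a b) b' = fold_op G V R S X a (fold_op G V R S X b b')"
proof (rule fold_op_obtain[OF X a(1,2)])
  fix D k1 k2 n d assume D: "disjoint_union G X X D k1 k2" and n: "n \<in> gmaps G D X"
    "\<And>x. x \<in> pts X \<Longrightarrow> n (k1 x) = x" "\<And>x. x \<in> pts X \<Longrightarrow> n (k2 x) = x"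
    and d: "d \<in> V D" "R X D k1 d = a" "R X D k2 d = b" and ab: "fold_op G V R S X a b = S D X n d"
  note D' = disjoint_unionD[OF D] and De = disjoint_union_eqs[OF D]
  obtain C :: "('g, 'u) gset" and i j where C: "disjoint_union G D X C i j"
    using disjoint_union_exists[OF inf_univ D'(3) X] by blast
  note C' = disjoint_unionD[OF C] and Ce = disjoint_union_eqs[OF C]
  obtain c where c: "c \<in> V C" "R D C i c = d" "R X C j c = b'"
    using coproduct_glue[OF disjoint_union_is_coproduct[OF C] d(1) a(3)] by blast
  note id = id_gmaps[OF X]
  obtain f where f: "f \<in> gmaps G C X" "\<And>x. x \<in> pts D \<Longrightarrow> f (i x) = n x"
    "\<And>x. x \<in> pts X \<Longrightarrow> f (j x) = gid X x"
    using disjoint_union_map[OF C n(1) id] by blast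
  \<comment> \<open>\<open>m\<close> is the first of the three copies of \<open>X\<close> in
    \<open>C\<close>; its complement \<open>B\<close> holds the other two.\<close>
  define m where "m = (\<lambda>x\<in>pts X. i (k1 x))"
  have m: "m \<in> gmaps G X C" unfolding m_def by (rule comp_gmaps[OF X D'(4) C'(4)])
  have "inj_on m (pts X)"
    by (auto simp: inj_on_def m_def Ce De gmaps_in[OF D'(4)])
  from disjoint_union_complement[OF X C'(3) m this]
  obtain B e where B: "disjoint_union G X B C m e" and B_def: "B = gsub C (pts C - m ` pts X)"
    and e_def: "e = gid B"
    by blast
  note B' = disjoint_unionD[OF B]
  have pB: "pts B = pts C - m ` pts X" by (simp add: B_def)
  \<comment> \<open>\<open>l1\<close> is the second copy; the third is \<open>j\<close>.\<close>
  define l1 where "l1 = (\<lambda>x\<in>pts X. i (k2 x))"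
  have l1: "l1 x \<in> pts B" "j x \<in> pts B" if "x \<in> pts X" for x
    using that gmaps_in[OF D'(4)] gmaps_in[OF D'(5)] gmaps_in[OF C'(4)] gmaps_in[OF C'(5)]
    by (auto simp: pB l1_def m_def Ce De)
  have aB: "act B g z = act C g z" if "z \<in> pts B" for g z using that by (simp add: B_def)
  have L: "disjoint_union G X X B l1 j"
    unfolding disjoint_union_def
  proof (intro conjI X B'(2))
    show "l1 \<in> gmaps G X B"
      using comp_gmaps[OF X D'(5) C'(4)] gmaps_act l1(1) aB gmaps_ext unfolding l1_def[symmetric]
      by (fastforce simp: gmaps_def)
    show "j \<in> gmaps G X B"
      using C'(5) l1(2) aB by (auto simp: gmaps_def)
    show "inj_on l1 (pts X)"
      by (auto simp: inj_on_def l1_def Ce De gmaps_in[OF D'(5)])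
    show "l1 ` pts X \<inter> j ` pts X = {}"
      by (auto simp: l1_def Ce gmaps_in[OF D'(5)])
    show "pts B = l1 ` pts X \<union> j ` pts X"
    proof
      show "l1 ` pts X \<union> j ` pts X \<subseteq> pts B" using l1 by auto
      show "pts B \<subseteq> l1 ` pts X \<union> j ` pts X"
        using C'(9) D'(9) by (auto simp: pB l1_def m_def)
    qed
  qed (fact C'(7))
  note L' = disjoint_unionD[OF L]
  have l1C: "l1 \<in> gmaps G X C" unfolding l1_def by (rule comp_gmaps[OF X D'(5) C'(4)])
  have fB: "(\<lambda>x\<in>pts B. f (e x)) \<in> gmaps G B X" by (rule comp_gmaps[OF B'(2,5) f(1)])
  have eB: "e x = x" if "x \<in> pts B" for x using that by (simp add: e_def)
  have cB: "R B C e c \<in> V B" by (rule R_closed[OF B'(2) B'(3) B'(5) c(1)])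
  have "S C X f c = fold_op G V R S X (S D X n (R D C i c)) (S X X (gid X) (R X C j c))"
    by (rule S_disjoint_union[OF C X f(1) n(1) f(2) id f(3) c(1)])
  then have 1: "S C X f c = fold_op G V R S X (fold_op G V R S X a b) b'"
    by (simp only: c ab S_gid[OF X a(3)])
  have "S C X f c = fold_op G V R S X (S X X (gid X) (R X C m c))
      (S B X (\<lambda>x\<in>pts B. f (e x)) (R B C e c))"
    by (rule S_disjoint_union[OF B X f(1) id _ fB _ c(1)])
      (auto simp: m_def f(2) n gmaps_in[OF D'(4)])
  also have "R X C m c = a"
    unfolding d(2)[symmetric] c(2)[symmetric]
    by (rule R_comp[symmetric]) (use X D' C' m c in \<open>auto simp: m_def\<close>)
  also have "S B X (\<lambda>x\<in>pts B. f (e x)) (R B C e c) =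
      fold_op G V R S X (R X B l1 (R B C e c)) (R X B j (R B C e c))"
    by (rule S_fold_map[OF L fB _ _ cB]) (use l1 f n in \<open>auto simp: eB l1_def gmaps_in[OF D'(5)]\<close>)
  also have "R X B l1 (R B C e c) = R X C l1 c"
    by (rule R_comp[OF X B'(2) B'(3) L'(4) B'(5) l1C _ c(1)]) (simp add: eB l1)
  also have "\<dots> = b"
    unfolding d(3)[symmetric] c(2)[symmetric]
    by (rule R_comp[symmetric]) (use X D' C' l1C c in \<open>auto simp: l1_def\<close>)
  also have "R X B j (R B C e c) = R X C j c"
    by (rule R_comp[OF X B'(2) B'(3) L'(5) B'(5) C'(5) _ c(1)]) (simp add: eB l1)
  finally show ?thesis by (simp only: 1 S_gid[OF X a(1)] c(3))
qed

lemma comm_monoid_fold: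
  assumes X: "fin_gset G X"
  shows "comm_monoid (fold_monoid G V R S X)"
  by (rule comm_monoidI)
    (auto simp: fold_monoid_def fold_op_closed[OF X] fold_unit_closed[OF X] fold_op_assoc[OF X]
      fold_op_comm[OF X fold_unit_closed[OF X]] fold_op_unit[OF X] intro: fold_op_comm[OF X])

text \<open>Doubling \<open>f\<close> gives a map of coproducts \<open>h\<close>, and the square
  that \<open>f\<close> and \<open>h\<close> form with the two folding maps is cartesian. Base
  change along it is the claim.\<close>

lemma R_fold_op:
  assumes X: "fin_gset G X" and Y: "fin_gset G Y" and f: "f \<in> gmaps G X Y"
    and a: "a \<in> V Y" and b: "b \<in> V Y"
  shows "R X Y f (fold_op G V R S Y a b) = fold_op G V R S X (R X Y f a) (R X Y f b)"
proof (rule fold_op_obtain[OF Y a b])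
  fix C i j n c assume C: "disjoint_union G Y Y C i j" and n: "n \<in> gmaps G C Y"
    "\<And>x. x \<in> pts Y \<Longrightarrow> n (i x) = x" "\<And>x. x \<in> pts Y \<Longrightarrow> n (j x) = x"
    and c: "c \<in> V C" "R Y C i c = a" "R Y C j c = b" and ab: "fold_op G V R S Y a b = S C Y n c"
  note C' = disjoint_unionD[OF C] and Ce = disjoint_union_eqs[OF C]
  obtain D :: "('g, 'u) gset" and k1 k2 where D: "disjoint_union G X X D k1 k2"
    using disjoint_union_exists[OF inf_univ X X] by blast
  note D' = disjoint_unionD[OF D] and De = disjoint_union_eqs[OF D]
  note id = id_gmaps[OF X]
  obtain p where p: "p \<in> gmaps G D X" "\<And>x. x \<in> pts X \<Longrightarrow> p (k1 x) = x"
    "\<And>x. x \<in> pts X \<Longrightarrow> p (k2 x) = x"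
    using disjoint_union_map[OF D id id] by auto
  obtain h where h: "h \<in> gmaps G D C" "\<And>x. x \<in> pts X \<Longrightarrow> h (k1 x) = i (f x)"
    "\<And>x. x \<in> pts X \<Longrightarrow> h (k2 x) = j (f x)"
    using disjoint_union_map[OF D comp_gmaps[OF X f C'(4)] comp_gmaps[OF X f C'(5)]] by auto
  have "is_pullback G D X C Y p h f n"
  proof (rule is_pullbackI[OF D'(3) X C'(3) Y p(1) h(1) f n(1)])
    fix z assume "z \<in> pts D"
    with D show "n (h z) = f (p z)"
      by (cases rule: disjoint_union_cases) (simp_all add: h p n gmaps_in[OF f])
  next
    fix z w assume z: "z \<in> pts D" and w: "w \<in> pts D" and e: "h z = h w" "p z = p w"
    show "z = w"
      using D z
    proof (cases rule: disjoint_union_cases)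
      case (1 x)
      show ?thesis using D w
        by (cases rule: disjoint_union_cases) (use 1 e in \<open>simp_all add: h p Ce gmaps_in[OF f]\<close>)
    next
      case (2 x)
      show ?thesis using D w
        by (cases rule: disjoint_union_cases) (use 2 e in \<open>simp_all add: h p Ce gmaps_in[OF f]\<close>)
    qed
  next
    fix z x assume "z \<in> pts C" and x: "x \<in> pts X" "n z = f x"
    from C this(1) show "\<exists>w\<in>pts D. h w = z \<and> p w = x"
    proof (cases rule: disjoint_union_cases)
      case (1 y)
      then show ?thesis using x n gmaps_in[OF D'(4) x(1)] by (intro bexI[of _ "k1 x"]) (auto simp: h p)
    next
      case (2 y)
      then show ?thesis using x n gmaps_in[OF D'(5) x(1)] by (intro bexI[of _ "k2 x"]) (auto simp: h p)
    qed
  qed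
  from base_change[OF this c(1)] have "R X Y f (S C Y n c) = S D X p (R D C h c)" .
  also have "\<dots> = fold_op G V R S X (R X D k1 (R D C h c)) (R X D k2 (R D C h c))"
    by (rule S_fold_map[OF D p R_closed[OF D'(3) C'(3) h(1) c(1)]])
  also have "R X D k1 (R D C h c) = R X C (\<lambda>x\<in>pts X. i (f x)) c"
    by (rule R_comp[OF X D'(3) C'(3) D'(4) h(1) comp_gmaps[OF X f C'(4)] _ c(1)]) (simp add: h)
  also have "\<dots> = R X Y f (R Y C i c)"
    by (rule R_comp[OF X Y C'(3) f C'(4) comp_gmaps[OF X f C'(4)] _ c(1), symmetric]) simp
  also have "R X D k2 (R D C h c) = R X C (\<lambda>x\<in>pts X. j (f x)) c"
    by (rule R_comp[OF X D'(3) C'(3) D'(5) h(1) comp_gmaps[OF X f C'(5)] _ c(1)]) (simp add: h)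
  also have "\<dots> = R X Y f (R Y C j c)"
    by (rule R_comp[OF X Y C'(3) f C'(5) comp_gmaps[OF X f C'(5)] _ c(1), symmetric]) simp
  finally show ?thesis by (simp add: ab c)
qed

end

section \<open>Tambara functors\<close>

locale tambara_functor_on = group G for G :: "('g, 'm) monoid_scheme" (structure) +
  fixes T :: "('g, 'u, 'a) tambara"
  assumes infinite_univ: "infinite (UNIV :: 'u set)"
    and tambara: "tambara_functor G T"
begin

sublocale tr: semi_mackey_functor G "val T" "res T" "tran T"
  by unfold_locales (use infinite_univ tambara in \<open>auto simp: tambara_functor_def mackey_def\<close>)

sublocale nm: semi_mackey_functor G "val T" "res T" "nrm T"
  by unfold_locales (use infinite_univ tambara in \<open>auto simp: tambara_functor_def\<close>)

lemma exponential:
  "is_exponential G A X Y Z P p f l r q \<Longrightarrow> a \<in> val T A \<Longrightarrow>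
    nrm T X Y f (tran T A X p a) = tran T P Y q (nrm T Z P r (res T Z A l a))"
  using tambara unfolding tambara_functor_def by blast

abbreviation add_at :: "('g, 'u) gset \<Rightarrow> 'a \<Rightarrow> 'a \<Rightarrow> 'a" where
  "add_at X \<equiv> fold_op G (val T) (res T) (tran T) X"

abbreviation mult_at :: "('g, 'u) gset \<Rightarrow> 'a \<Rightarrow> 'a \<Rightarrow> 'a" where
  "mult_at X \<equiv> fold_op G (val T) (res T) (nrm T) X"

text \<open>The exponential diagram behind \<open>(b + c) a = b a + c a\<close>: a section over the fibre
  \<open>{d1 x, d2 x}\<close> of the folding map is determined by the one of the two copies of \<open>x\<close> that it
  selects over \<open>d1 x\<close>, so the dependent product is \<open>D\<close> itself.\<close>

lemma exponential_fold:
  fixes D X A Z :: "('g, 'u) gset"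
  assumes D: "disjoint_union G X X D d1 d2" and n: "n \<in> gmaps G D X"
    "\<And>x. x \<in> pts X \<Longrightarrow> n (d1 x) = x" "\<And>x. x \<in> pts X \<Longrightarrow> n (d2 x) = x"
    and A: "disjoint_union G D X A m1 m2" and p: "p \<in> gmaps G A D"
    "\<And>w. w \<in> pts D \<Longrightarrow> p (m1 w) = d1 (n w)" "\<And>x. x \<in> pts X \<Longrightarrow> p (m2 x) = d2 x"
    and Z: "disjoint_union G D D Z z1 z2" and r: "r \<in> gmaps G Z D"
    "\<And>w. w \<in> pts D \<Longrightarrow> r (z1 w) = w" "\<And>w. w \<in> pts D \<Longrightarrow> r (z2 w) = w"
    and l: "l \<in> gmaps G Z A"
    "\<And>w. w \<in> pts D \<Longrightarrow> l (z1 w) = m1 w" "\<And>w. w \<in> pts D \<Longrightarrow> l (z2 w) = m2 (n w)"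
  shows "is_exponential G A D X Z D p n l r n"
proof -
  note D' = disjoint_unionD[OF D] and De = disjoint_union_eqs[OF D]
  note A' = disjoint_unionD[OF A] and Ae = disjoint_union_eqs[OF A]
  note Z' = disjoint_unionD[OF Z]
  note X = D'(1)
  let ?\<Pi> = "dep_prod G A D X p n"
  have nX: "n w \<in> pts X" if "w \<in> pts D" for w using gmaps_in[OF n(1) that] .
  have dD: "d1 x \<in> pts D" "d2 x \<in> pts D" if "x \<in> pts X" for x
    using that gmaps_in[OF D'(4)] gmaps_in[OF D'(5)] by auto
  have mA: "w \<in> pts D \<Longrightarrow> m1 w \<in> pts A" "x \<in> pts X \<Longrightarrow> m2 x \<in> pts A" for x w
    using gmaps_in[OF A'(4)] gmaps_in[OF A'(5)] by auto
  have fib: "fib D n x = {d1 x, d2 x}" if x: "x \<in> pts X" for x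
  proof
    show "fib D n x \<subseteq> {d1 x, d2 x}"
    proof
      fix w assume w: "w \<in> fib D n x"
      then have "w \<in> pts D" by (simp add: fib_def)
      with D show "w \<in> {d1 x, d2 x}"
        by (cases rule: disjoint_union_cases) (use w n in \<open>auto simp: fib_def\<close>)
    qed
  qed (use dD n x in \<open>auto simp: fib_def\<close>)
  \<comment> \<open>\<open>w\<close> is the free choice over \<open>d1 (n w)\<close>. Over
    \<open>d2 (n w)\<close> nothing can be chosen: the only point of \<open>A\<close> above it is
    \<open>m2 (n w)\<close>.\<close>
  define sec where "sec w = (\<lambda>v\<in>fib D n (n w). if v = d1 (n w) then m1 w else m2 (n w))" for w
  have sec: "sec w (d1 (n w)) = m1 w" "sec w (d2 (n w)) = m2 (n w)" if "w \<in> pts D" for w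
    using that nX[OF that] De(4) by (simp_all add: sec_def fib)
  define h where "h = (\<lambda>w\<in>pts D. (n w, sec w))"
  have hw: "h w = (n w, sec w)" if "w \<in> pts D" for w using that by (simp add: h_def)
  have h_in: "h w \<in> dep_prod_pts A D X p n" if w: "w \<in> pts D" for w
    using w nX[OF w] De(4) mA p by (auto simp: hw dep_prod_pts_def fib sec_def)
  have h_act: "h (act D g w) = act ?\<Pi> g (h w)" if g: "g \<in> carrier G" and w: "w \<in> pts D" for g w
  proof -
    have gw: "act D g w \<in> pts D" and gn: "act X g (n w) \<in> pts X"
      using act_in[OF D'(3) g w] act_in[OF X g nX[OF w]] by auto
    have ng: "n (act D g w) = act X g (n w)" by (rule gmaps_act[OF n(1) g w])
    have d: "d1 (act X g (n w)) = act D g (d1 (n w))" "d2 (act X g (n w)) = act D g (d2 (n w))"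
      by (rule gmaps_act[OF D'(4) g nX[OF w]], rule gmaps_act[OF D'(5) g nX[OF w]])
    have "sec (act D g w) = (\<lambda>x\<in>fib D n (act X g (n w)). act A g (sec w (act D (inv g) x)))"
    proof (rule extensionalityI[of _ "fib D n (act X g (n w))"])
      fix v assume "v \<in> fib D n (act X g (n w))"
      then consider "v = d1 (act X g (n w))" | "v = d2 (act X g (n w))" by (auto simp: fib[OF gn])
      then show "sec (act D g w) v = (\<lambda>x\<in>fib D n (act X g (n w)). act A g (sec w (act D (inv g) x))) v"
      proof cases
        case 1
        then have "sec (act D g w) v = m1 (act D g w)" using sec(1)[OF gw] ng by simp
        moreover have "act D (inv g) v = d1 (n w)"
          using 1 d act_inv(1)[OF D'(3) g dD(1)[OF nX[OF w]]] by simp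
        ultimately show ?thesis
          using 1 sec(1)[OF w] gmaps_act[OF A'(4) g w] by (simp add: fib[OF gn])
      next
        case 2
        then have "sec (act D g w) v = m2 (act X g (n w))" using sec(2)[OF gw] ng by simp
        moreover have "act D (inv g) v = d2 (n w)"
          using 2 d act_inv(1)[OF D'(3) g dD(2)[OF nX[OF w]]] by simp
        ultimately show ?thesis
          using 2 sec(2)[OF w] gmaps_act[OF A'(5) g nX[OF w]] by (simp add: fib[OF gn])
      qed
    qed (auto simp: sec_def ng)
    then show ?thesis
      using h_in[OF w] by (simp add: hw w gw ng dep_prod_def)
  qed
  have h_gmap: "h \<in> gmaps G D ?\<Pi>"
    unfolding gmaps_def using h_in h_act by (auto simp: dep_prod_def h_def)
  have h_inj: "inj_on h (pts D)"
  proof (rule inj_onI)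
    fix w v assume w: "w \<in> pts D" and v: "v \<in> pts D" and "h w = h v"
    then have "n w = n v" "sec w = sec v" by (simp_all add: hw)
    then have "m1 w = m1 v" using sec(1)[OF w] sec(1)[OF v] by simp
    then show "w = v" using Ae(1) w v by simp
  qed
  have h_surj: "\<exists>w\<in>pts D. h w = (x, \<sigma>)" if \<sigma>: "(x, \<sigma>) \<in> dep_prod_pts A D X p n" for x \<sigma>
  proof -
    have x: "x \<in> pts X" and \<sigma>A: "\<sigma> \<in> fib D n x \<rightarrow>\<^sub>E pts A" and \<sigma>p: "\<forall>v\<in>fib D n x. p (\<sigma> v) = v"
      using \<sigma> by (auto simp: dep_prod_pts_def)
    have 1: "\<sigma> (d1 x) \<in> pts A" "p (\<sigma> (d1 x)) = d1 x" and 2: "\<sigma> (d2 x) \<in> pts A" "p (\<sigma> (d2 x)) = d2 x"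
      using \<sigma>A \<sigma>p by (auto simp: fib[OF x])
    from A 1(1) obtain w where w: "w \<in> pts D" "\<sigma> (d1 x) = m1 w"
      by (cases rule: disjoint_union_cases) (use 1(2) x p De in auto)
    then have nw: "n w = x" using 1(2) p(2) De(1) nX x by auto
    from A 2(1) have s2: "\<sigma> (d2 x) = m2 x"
      by (cases rule: disjoint_union_cases) (use 2(2) x p De nX in auto)
    have "sec w = \<sigma>"
    proof (rule extensionalityI[of _ "fib D n x"])
      show "sec w \<in> extensional (fib D n x)" by (simp add: sec_def nw)
      show "\<sigma> \<in> extensional (fib D n x)" using \<sigma>A by (auto simp: PiE_def)
      show "sec w v = \<sigma> v" if "v \<in> fib D n x" for v
        using that sec[OF w(1)] w(2) s2 nw by (auto simp: fib[OF x])
    qed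
    then show ?thesis using w(1) nw hw by (intro bexI[of _ w]) auto
  qed
  have h: "gset_iso G D ?\<Pi> h"
  proof -
    have "pts ?\<Pi> \<subseteq> h ` pts D" using h_surj by (force simp: dep_prod_def)
    then show ?thesis
      using h_gmap h_inj h_in by (auto simp: gset_iso_def bij_betw_def dep_prod_def)
  qed
  \<comment> \<open>\<open>e\<close> is the other projection of the fibre product: it gives the
    point at which the section \<open>sec (r z)\<close> is to be evaluated, \<open>d1\<close> on the
    first half of \<open>Z\<close> and \<open>d2\<close> on the second.\<close>
  obtain e where e: "e \<in> gmaps G Z D" "\<And>w. w \<in> pts D \<Longrightarrow> e (z1 w) = d1 (n w)"
    "\<And>w. w \<in> pts D \<Longrightarrow> e (z2 w) = d2 (n w)"
    using disjoint_union_map[OF Z comp_gmaps[OF D'(3) n(1) D'(4)] comp_gmaps[OF D'(3) n(1) D'(5)]]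
    by auto
  have ne: "n (e z) = n (r z)" if "z \<in> pts Z" for z
    using Z that by (cases rule: disjoint_union_cases) (simp_all add: e r n nX)
  let ?F = "fib_prod D ?\<Pi> n fst"
  define k where "k = (\<lambda>z\<in>pts Z. (e z, h (r z)))"
  have kz: "k z = (e z, h (r z))" if "z \<in> pts Z" for z using that by (simp add: k_def)
  have eD: "e z \<in> pts D" "r z \<in> pts D" if "z \<in> pts Z" for z
    using that gmaps_in[OF e(1)] gmaps_in[OF r(1)] by auto
  have k_in: "k z \<in> fib_prod_pts D ?\<Pi> n fst" if z: "z \<in> pts Z" for z
    using z eD[OF z] h_in[OF eD(2)[OF z]] ne[OF z]
    by (simp add: kz fib_prod_pts_def hw dep_prod_def)
  have k_act: "k (act Z g z) = act ?F g (k z)" if g: "g \<in> carrier G" and z: "z \<in> pts Z" for g z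
    using g z k_in[OF z] act_in[OF Z'(3) g z] gmaps_act[OF e(1) g z] gmaps_act[OF r(1) g z]
      h_act[OF g eD(2)[OF z]]
    by (simp add: kz fib_prod_def)
  have k: "gset_iso G Z ?F k"
    unfolding gset_iso_def
  proof
    show "k \<in> gmaps G Z ?F"
      unfolding gmaps_def using k_in k_act by (auto simp: fib_prod_def k_def)
    have "inj_on k (pts Z)"
    proof (rule inj_onI)
      fix z z' assume z: "z \<in> pts Z" and z': "z' \<in> pts Z" and "k z = k z'"
      then have *: "e z = e z'" "r z = r z'"
        using h_inj eD by (auto simp: kz inj_on_def)
      show "z = z'" using Z z
      proof (cases rule: disjoint_union_cases)
        case (1 w)
        show ?thesis using Z z'
          by (cases rule: disjoint_union_cases) (use * 1 in \<open>auto simp: e r De nX\<close>)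
      next
        case (2 w)
        show ?thesis using Z z'
          by (cases rule: disjoint_union_cases) (use * 2 in \<open>auto simp: e r De nX\<close>)
      qed
    qed
    moreover have "pts ?F \<subseteq> k ` pts Z"
    proof
      fix y assume y: "y \<in> pts ?F"
      then obtain v \<pi> where y': "y = (v, \<pi>)" "v \<in> pts D" "\<pi> \<in> dep_prod_pts A D X p n" "n v = fst \<pi>"
        by (auto simp: fib_prod_def fib_prod_pts_def dep_prod_def)
      then obtain w where w: "w \<in> pts D" "h w = \<pi>" using h_surj[of "fst \<pi>" "snd \<pi>"] by auto
      then have "n v = n w" using y' by (auto simp: hw)
      then have "v \<in> fib D n (n w)" using y' by (simp add: fib_def)
      then consider "v = d1 (n w)" | "v = d2 (n w)" by (auto simp: fib nX w)
      then show "y \<in> k ` pts Z"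
      proof cases
        case 1
        have "z1 w \<in> pts Z" using gmaps_in[OF Z'(4) w(1)] .
        moreover from this have "k (z1 w) = y" using 1 w y' by (simp add: kz e r)
        ultimately show ?thesis by blast
      next
        case 2
        have "z2 w \<in> pts Z" using gmaps_in[OF Z'(5) w(1)] .
        moreover from this have "k (z2 w) = y" using 2 w y' by (simp add: kz e r)
        ultimately show ?thesis by blast
      qed
    qed
    ultimately show "bij_betw k (pts Z) (pts ?F)"
      using k_in by (auto simp: bij_betw_def fib_prod_def)
  qed
  have "l z = snd (snd (k z)) (fst (k z))" if z: "z \<in> pts Z" for z
    using Z z
  proof (cases rule: disjoint_union_cases)
    case (1 w)
    then show ?thesis using z by (simp add: kz hw l e r sec)
  next
    case (2 w)
    then show ?thesis using z by (simp add: kz hw l e r sec)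
  qed
  then show ?thesis
    unfolding is_exponential_def
    using A'(3) D'(3) X Z'(3) p(1) n(1) l(1) r(1) h k hw kz
    by (intro conjI exI[of _ h] exI[of _ k]) auto
qed

text \<open>The left side is the norm along the folding map \<open>n\<close> of the pair (b + c, a).
  That pair is the transfer along \<open>p\<close> of \<open>s\<close>, with coordinates
  \<open>d\<close> = (b, c) and \<open>a\<close>. The exponential formula turns the norm into the
  transfer along \<open>n\<close> of \<open>d\<close> times the restriction of \<open>a\<close> to
  \<open>D\<close>, whose coordinates are b a and c a.\<close>

lemma mult_add_distrib:
  assumes X: "fin_gset G X" and b: "b \<in> val T X" and c: "c \<in> val T X" and a: "a \<in> val T X"
  shows "mult_at X (add_at X b c) a = add_at X (mult_at X b a) (mult_at X c a)"
proof (rule tr.fold_op_obtain[OF X b c])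
  fix D d1 d2 n d assume D: "disjoint_union G X X D d1 d2" and n: "n \<in> gmaps G D X"
    "\<And>x. x \<in> pts X \<Longrightarrow> n (d1 x) = x" "\<And>x. x \<in> pts X \<Longrightarrow> n (d2 x) = x"
    and d: "d \<in> val T D" "res T X D d1 d = b" "res T X D d2 d = c" and bc: "add_at X b c = tran T D X n d"
  note D' = disjoint_unionD[OF D] and De = disjoint_union_eqs[OF D]
  have nX: "n w \<in> pts X" if "w \<in> pts D" for w using gmaps_in[OF n(1) that] .
  obtain A :: "('g, 'u) gset" and m1 m2 where A: "disjoint_union G D X A m1 m2"
    using disjoint_union_exists[OF infinite_univ D'(3) X] by blast
  note A' = disjoint_unionD[OF A] and Ae = disjoint_union_eqs[OF A]
  obtain s where s: "s \<in> val T A" "res T D A m1 s = d" "res T X A m2 s = a"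
    using tr.coproduct_glue[OF disjoint_union_is_coproduct[OF A] d(1) a] by blast
  obtain p where p: "p \<in> gmaps G A D" "\<And>w. w \<in> pts D \<Longrightarrow> p (m1 w) = d1 (n w)"
    "\<And>x. x \<in> pts X \<Longrightarrow> p (m2 x) = d2 x"
    using disjoint_union_map[OF A comp_gmaps[OF D'(3) n(1) D'(4)] D'(5)] by auto
  obtain Z :: "('g, 'u) gset" and z1 z2 where Z: "disjoint_union G D D Z z1 z2"
    using disjoint_union_exists[OF infinite_univ D'(3) D'(3)] by blast
  note Z' = disjoint_unionD[OF Z]
  obtain r where r: "r \<in> gmaps G Z D" "\<And>w. w \<in> pts D \<Longrightarrow> r (z1 w) = w"
    "\<And>w. w \<in> pts D \<Longrightarrow> r (z2 w) = w"
    using disjoint_union_map[OF Z id_gmaps[OF D'(3)] id_gmaps[OF D'(3)]] by auto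
  have m2n: "(\<lambda>w\<in>pts D. m2 (n w)) \<in> gmaps G D A" by (rule comp_gmaps[OF D'(3) n(1) A'(5)])
  obtain l where l: "l \<in> gmaps G Z A" "\<And>w. w \<in> pts D \<Longrightarrow> l (z1 w) = m1 w"
    "\<And>w. w \<in> pts D \<Longrightarrow> l (z2 w) = m2 (n w)"
    using disjoint_union_map[OF Z A'(4) m2n] by auto
  note ex = exponential[OF exponential_fold[OF D n A p Z r l] s(1)]
  have t: "tran T A D p s \<in> val T D" by (rule tr.S_closed[OF A'(3) D'(3) p(1) s(1)])
  \<comment> \<open>Over the first copy of \<open>X\<close> the map \<open>p\<close> is the folding
    map, which adds \<open>b\<close> and \<open>c\<close>; over the second it is the identity, which
    keeps \<open>a\<close>.\<close>
  have "is_pullback G D X A D n m1 d1 p"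
  proof (rule is_pullbackI[OF D'(3) X A'(3) D'(3) n(1) A'(4) D'(4) p(1)])
    fix z x assume "z \<in> pts A" and x: "x \<in> pts X" "p z = d1 x"
    from A this(1) show "\<exists>w\<in>pts D. m1 w = z \<and> n w = x"
      by (cases rule: disjoint_union_cases) (use x p De nX in auto)
  qed (simp_all add: p Ae)
  from tr.base_change[OF this s(1)] have t1: "res T X D d1 (tran T A D p s) = add_at X b c"
    by (simp add: s bc)
  have "is_pullback G X X A D (gid X) m2 d2 p"
  proof (rule is_pullbackI[OF X X A'(3) D'(3) id_gmaps[OF X] A'(5) D'(5) p(1)])
    fix z x assume "z \<in> pts A" and x: "x \<in> pts X" "p z = d2 x"
    from A this(1) show "\<exists>w\<in>pts X. m2 w = z \<and> gid X w = x"
      by (cases rule: disjoint_union_cases) (use x p De nX in auto)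
  qed (simp_all add: p Ae)
  from tr.base_change[OF this s(1)] have t2: "res T X D d2 (tran T A D p s) = a"
    by (simp only: s tr.S_gid[OF X a])
  let ?na = "res T D X n a"
  have na: "?na \<in> val T D" by (rule tr.R_closed[OF D'(3) X n(1) a])
  have R: "res T X D d1 ?na = a" "res T X D d2 ?na = a"
    using tr.R_comp[OF X D'(3) X D'(4) n(1) id_gmaps[OF X] _ a] tr.R_gid[OF X a]
      tr.R_comp[OF X D'(3) X D'(5) n(1) id_gmaps[OF X] _ a] n by (metis restrict_apply')+
  have ls: "res T Z A l s \<in> val T Z" by (rule tr.R_closed[OF Z'(3) A'(3) l(1) s(1)])
  have "mult_at X (add_at X b c) a = nrm T D X n (tran T A D p s)"
    using nm.S_fold_map[OF D n t] t1 t2 by simp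
  also have "\<dots> = tran T D X n (nrm T Z D r (res T Z A l s))" by (rule ex)
  also have "nrm T Z D r (res T Z A l s) =
      mult_at D (res T D Z z1 (res T Z A l s)) (res T D Z z2 (res T Z A l s))"
    by (rule nm.S_fold_map[OF Z r ls])
  also have "res T D Z z1 (res T Z A l s) = res T D A m1 s"
    by (rule tr.R_comp[OF D'(3) Z'(3) A'(3) Z'(4) l(1) A'(4) _ s(1)]) (simp add: l)
  also have "\<dots> = d" by (rule s)
  also have "res T D Z z2 (res T Z A l s) = res T D A (\<lambda>w\<in>pts D. m2 (n w)) s"
    by (rule tr.R_comp[OF D'(3) Z'(3) A'(3) Z'(5) l(1) m2n _ s(1)]) (simp add: l)
  also have "\<dots> = res T D X n (res T X A m2 s)"
    by (rule tr.R_comp[OF D'(3) X A'(3) n(1) A'(5) m2n _ s(1), symmetric]) simp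
  also have "\<dots> = ?na" by (simp only: s)
  also have "tran T D X n (mult_at D d ?na) =
      add_at X (res T X D d1 (mult_at D d ?na)) (res T X D d2 (mult_at D d ?na))"
    by (rule tr.S_fold_map[OF D n nm.fold_op_closed[OF D'(3) d(1) na]])
  also have "res T X D d1 (mult_at D d ?na) = mult_at X b a"
    by (simp add: nm.R_fold_op[OF X D'(3) D'(4) d(1) na] d R)
  also have "res T X D d2 (mult_at D d ?na) = mult_at X c a"
    by (simp add: nm.R_fold_op[OF X D'(3) D'(5) d(1) na] d R)
  finally show ?thesis .
qed

section \<open>The rings of values and the norm of zero\<close>

lemma tring_sel [simp]:
  "carrier (tring G T X) = val T X"
  "mult (tring G T X) = mult_at X"
  "one (tring G T X) = fold_unit G (val T) (nrm T) X"
  "zero (tring G T X) = fold_unit G (val T) (tran T) X"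
  "add (tring G T X) = add_at X"
  by (simp_all add: tring_def)

lemma tring_cring:
  assumes X: "fin_gset G X"
  shows "cring (tring G T X)"
proof (rule cringI)
  interpret A: comm_group "fold_monoid G (val T) (res T) (tran T) X"
    using tambara X by (auto simp: tambara_functor_def mackey_def)
  have "add_monoid (tring G T X) = fold_monoid G (val T) (res T) (tran T) X"
    by (simp add: tring_def fold_monoid_def)
  then show "abelian_group (tring G T X)"
    using abelian_group.intro abelian_group_axioms.intro abelian_monoid.intro
      A.comm_group_axioms A.comm_monoid_axioms by metis
  interpret M: comm_monoid "fold_monoid G (val T) (res T) (nrm T) X"
    by (rule nm.comm_monoid_fold[OF X])
  show "comm_monoid (tring G T X)"
    using M.m_closed M.one_closed M.m_assoc M.l_one M.m_comm
    by (intro comm_monoidI) (simp_all add: fold_monoid_def)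
qed (simp add: mult_add_distrib[OF X])

lemma tring_ring: "fin_gset G X \<Longrightarrow> ring (tring G T X)"
  using tring_cring cring.axioms(1) by blast

lemma res_ring_hom:
  assumes "fin_gset G X" "fin_gset G Y" "f \<in> gmaps G X Y"
  shows "ring_hom_ring (tring G T Y) (tring G T X) (res T X Y f)"
  by (rule ring_hom_ringI)
    (simp_all add: tring_ring assms tr.R_closed[OF assms] tr.R_fold_op[OF assms]
      nm.R_fold_op[OF assms] nm.R_fold_unit[OF assms])

text \<open>Zero is a transfer from an empty G-set. Over a surjection every fibre is nonempty and
  admits no map to the empty set, so the dependent product is empty and the exponential formula
  returns a transfer from an empty G-set, which is zero again.\<close>

lemma nrm_zero_surj:
  assumes X: "fin_gset G X" and Y: "fin_gset G Y" and f: "f \<in> gmaps G X Y"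
    and surj: "f ` pts X = pts Y"
  shows "nrm T X Y f \<zero>\<^bsub>tring G T X\<^esub> = \<zero>\<^bsub>tring G T Y\<^esub>"
proof (rule tr.empty_gset_obtain)
  fix E :: "('g, 'u) gset" and c assume E: "fin_gset G E" "pts E = {}" and c: "c \<in> val T E"
  let ?m = "\<lambda>_. undefined"
  have m: "?m \<in> gmaps G E W" for W :: "('g, 'x) gset" by (rule empty_gmaps[OF E(2)])
  have "fib X f y \<noteq> {}" if "y \<in> pts Y" for y
  proof -
    obtain x where "x \<in> pts X" "f x = y" using surj \<open>y \<in> pts Y\<close> by (metis imageE)
    then show ?thesis by (auto simp: fib_def)
  qed
  then have "fib X f y \<rightarrow>\<^sub>E pts E = {}" if "y \<in> pts Y" for y
    using that by (simp add: E(2) PiE_eq_empty_iff ex_in_conv)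
  then have "dep_prod_pts E X Y ?m f = {}"
    by (auto simp: dep_prod_pts_def)
  then have P: "pts (dep_prod G E X Y ?m f) = {}"
    and "pts (fib_prod X (dep_prod G E X Y ?m f) f fst) = {}"
    by (simp_all add: dep_prod_def fib_prod_def fib_prod_pts_def)
  then have "is_exponential G E X Y E E ?m f ?m ?m ?m"
    unfolding is_exponential_def gset_iso_def using X Y E f m
    by (intro conjI exI[of _ "\<lambda>_. undefined"]) (auto simp: empty_gmaps[OF E(2)] bij_betw_def)
  from exponential[OF this c] show ?thesis
    unfolding tring_sel tr.fold_unit_eq[OF X E m c]
    using tr.fold_unit_eq[OF Y E m nm.S_closed[OF E(1) E(1) m tr.R_closed[OF E(1) E(1) m c]]]
    by metis
qed

end

lemma ideal_closed:
  assumes "ideal I R"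
  shows "\<zero>\<^bsub>R\<^esub> \<in> I" "a \<in> I \<Longrightarrow> b \<in> I \<Longrightarrow> a \<oplus>\<^bsub>R\<^esub> b \<in> I" "a \<in> I \<Longrightarrow> \<ominus>\<^bsub>R\<^esub> a \<in> I"
proof -
  interpret ideal I R by (rule assms)
  show "\<zero>\<^bsub>R\<^esub> \<in> I" by (rule additive_subgroup.zero_closed[OF is_additive_subgroup])
  show "a \<in> I \<Longrightarrow> b \<in> I \<Longrightarrow> a \<oplus>\<^bsub>R\<^esub> b \<in> I"
    by (rule additive_subgroup.a_closed[OF is_additive_subgroup])
  show "a \<in> I \<Longrightarrow> \<ominus>\<^bsub>R\<^esub> a \<in> I"
    by (rule additive_subgroup.a_inv_closed[OF is_additive_subgroup])
qed

section \<open>The zero ideal and ideals containing a unit\<close>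

context tambara_functor_on
begin

text \<open>The condition on norms holds with summand 0, whatever the norm of 0 may be.\<close>

lemma zero_tambara_ideal: "tambara_ideal G T (\<lambda>X. {\<zero>\<^bsub>tring G T X\<^esub>})"
  unfolding tambara_ideal_def
proof (intro conjI allI impI)
  fix X :: "('g, 'u) gset" assume "fin_gset G X"
  then interpret ring "tring G T X" by (rule tring_ring)
  show "ideal {\<zero>\<^bsub>tring G T X\<^esub>} (tring G T X)" by (rule zeroideal)
next
  fix X Y :: "('g, 'u) gset" and f assume *: "fin_gset G X \<and> fin_gset G Y \<and> f \<in> gmaps G X Y"
  then have X: "fin_gset G X" and Y: "fin_gset G Y" and f: "f \<in> gmaps G X Y" by auto
  show "res T X Y f ` {\<zero>\<^bsub>tring G T Y\<^esub>} \<subseteq> {\<zero>\<^bsub>tring G T X\<^esub>}"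
    by (simp add: tr.R_fold_unit[OF X Y f])
  show "tran T X Y f ` {\<zero>\<^bsub>tring G T X\<^esub>} \<subseteq> {\<zero>\<^bsub>tring G T Y\<^esub>}"
    by (simp add: tr.S_fold_unit[OF X Y f])
  show "nrm T X Y f ` {\<zero>\<^bsub>tring G T X\<^esub>} \<subseteq>
      {nrm T X Y f \<zero>\<^bsub>tring G T X\<^esub> \<oplus>\<^bsub>tring G T Y\<^esub> b |b. b \<in> {\<zero>\<^bsub>tring G T Y\<^esub>}}"
    using tr.fold_op_unit[OF Y nm.S_closed[OF X Y f tr.fold_unit_closed[OF X]]] by simp
qed

text \<open>The norm to a point is unital and kills zero, so a unit at a nonempty level spreads to the
  point and from there, by restriction, everywhere.\<close>

lemma tambara_ideal_eq_top:
  assumes I: "tambara_ideal G T I" and E: "fin_gset G E" "pts E \<noteq> {}"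
    and one: "\<one>\<^bsub>tring G T E\<^esub> \<in> I E" and X: "fin_gset G X"
  shows "I X = val T X"
proof -
  define P :: "('g, 'u) gset" where "P = \<lparr>pts = {undefined}, act = \<lambda>_. \<lambda>x\<in>{undefined}. x\<rparr>"
  have P: "fin_gset G P" by (rule fin_gsetI) (auto simp: P_def)
  have m: "(\<lambda>w\<in>pts W. undefined) \<in> gmaps G W P" if "fin_gset G W" for W :: "('g, 'u) gset"
    by (rule restrict_gmaps) (use that act_in in \<open>auto simp: P_def\<close>)
  have ideal: "ideal (I Y) (tring G T Y)" if "fin_gset G Y" for Y
    using I that by (auto simp: tambara_ideal_def)
  let ?f = "\<lambda>w\<in>pts E. undefined" and ?k = "\<lambda>w\<in>pts X. undefined"
  have "nrm T E P ?f ` I E \<subseteq> {nrm T E P ?f \<zero>\<^bsub>tring G T E\<^esub> \<oplus>\<^bsub>tring G T P\<^esub> b |b. b \<in> I P}"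
    using I E(1) P m[OF E(1)] unfolding tambara_ideal_def by blast
  then obtain b where b: "b \<in> I P"
    "nrm T E P ?f \<one>\<^bsub>tring G T E\<^esub> = nrm T E P ?f \<zero>\<^bsub>tring G T E\<^esub> \<oplus>\<^bsub>tring G T P\<^esub> b"
    using one by blast
  interpret P: ideal "I P" "tring G T P" by (rule ideal[OF P])
  \<comment> \<open>A nonempty \<open>E\<close> surjects onto the point, so the norm of zero drops
    out of the ideal condition.\<close>
  have "?f ` pts E = pts P" using E(2) by (auto simp: P_def)
  from nrm_zero_surj[OF E(1) P m[OF E(1)] this] b P.a_Hcarr[OF b(1)]
  have "nrm T E P ?f \<one>\<^bsub>tring G T E\<^esub> = b" using P.l_zero by simp
  then have "\<one>\<^bsub>tring G T P\<^esub> \<in> I P"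
    using nm.S_fold_unit[OF E(1) P m[OF E(1)]] b(1) by simp
  moreover have "res T X P ?k ` I P \<subseteq> I X"
    using I X P m[OF X] unfolding tambara_ideal_def by blast
  ultimately have "\<one>\<^bsub>tring G T X\<^esub> \<in> I X"
    using nm.R_fold_unit[OF X P m[OF X]] by force
  then show ?thesis using ideal.one_imp_carrier[OF ideal[OF X]] by simp
qed

end

section \<open>The free orbit\<close>

text \<open>G/e is represented by a G-set \<open>E\<close> with a base point \<open>e\<close> on
  which G acts simply transitively. This records its universal property, that maps out of
  \<open>E\<close> are the same as points of the target, without tying it to cosets.\<close>

locale tambara_free_orbit = tambara_functor_on G T
  for G :: "('g, 'm) monoid_scheme" (structure) and T :: "('g, 'u, 'a) tambara" +
  fixes E :: "('g, 'u) gset" and e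
  assumes fin_E: "fin_gset G E" and e_in: "e \<in> pts E"
    and free: "bij_betw (\<lambda>g. act E g e) (carrier G) (pts E)"
begin

text \<open>By freeness each point of \<open>E\<close> is \<open>act E g e\<close> for exactly one
  \<open>g\<close>, which \<open>c\<close> recovers; sending that point to \<open>act X g x\<close>
  is therefore well defined.\<close>

lemma orbit_map_exists:
  assumes X: "fin_gset G X" and x: "x \<in> pts X"
  obtains \<gamma> where "\<gamma> \<in> gmaps G E X" "\<gamma> e = x"
proof -
  define c where "c = the_inv_into (carrier G) (\<lambda>g. act E g e)"
  have c: "c (act E g e) = g" if "g \<in> carrier G" for g
    using the_inv_into_f_f[OF bij_betw_imp_inj_on[OF free] that] by (simp add: c_def)
  have orb: "\<exists>g\<in>carrier G. z = act E g e" if "z \<in> pts E" for z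
    using free that by (auto simp: bij_betw_def)
  have "(\<lambda>z\<in>pts E. act X (c z) x) \<in> gmaps G E X"
  proof (rule restrict_gmaps)
    fix g z assume g: "g \<in> carrier G" and "z \<in> pts E"
    then obtain k where k: "k \<in> carrier G" "z = act E k e" using orb by blast
    then show "act X (c (act E g z)) x = act X g (act X (c z) x)"
      using g by (simp add: act_mult[OF fin_E, symmetric] e_in c act_mult[OF X] x)
  next
    fix z assume "z \<in> pts E"
    then show "act X (c z) x \<in> pts X" using orb c act_in[OF X _ x] by metis
  qed (rule act_in[OF fin_E])
  moreover have "act X (c e) x = x"
    using c[OF one_closed] act_one[OF fin_E e_in] act_one[OF X x] by simp
  ultimately show ?thesis using that e_in by simp
qed

lemma orbit_map_eqI:
  assumes "\<gamma> \<in> gmaps G E X" "\<delta> \<in> gmaps G E X" "\<gamma> e = \<delta> e"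
  shows "\<gamma> = \<delta>"
proof (rule gmaps_eqI[OF assms(1,2)])
  fix z assume "z \<in> pts E"
  then obtain g where "g \<in> carrier G" "z = act E g e" using free by (auto simp: bij_betw_def)
  then show "\<gamma> z = \<delta> z"
    using gmaps_act[OF assms(1) _ e_in] gmaps_act[OF assms(2) _ e_in] assms(3) by simp
qed

text \<open>If \<open>s e = act E k e\<close>, then \<open>s\<close> acts on the group elements
  labelling the points as right multiplication by \<open>k\<close>. Cancellation gives injectivity
  and finiteness the rest.\<close>

lemma endo_iso:
  assumes s: "s \<in> gmaps G E E"
  shows "gset_iso G E E s"
proof -
  have orb: "\<exists>g\<in>carrier G. z = act E g e" if "z \<in> pts E" for z
    using free that by (auto simp: bij_betw_def)
  have cancel: "g = h" if "g \<in> carrier G" "h \<in> carrier G" "act E g e = act E h e" for g h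
    using free that by (auto simp: bij_betw_def inj_on_def)
  obtain k where k: "k \<in> carrier G" "s e = act E k e" using orb gmaps_in[OF s e_in] by blast
  have "inj_on s (pts E)"
  proof (rule inj_onI)
    fix z w assume "z \<in> pts E" "w \<in> pts E" and eq: "s z = s w"
    then obtain g h where gh: "g \<in> carrier G" "z = act E g e" "h \<in> carrier G" "w = act E h e"
      using orb by metis
    then have "act E (g \<otimes> k) e = act E (h \<otimes> k) e"
      using eq gmaps_act[OF s _ e_in] k by (simp add: act_mult[OF fin_E _ _ e_in])
    then have "g \<otimes> k = h \<otimes> k" using cancel gh k by blast
    then show "z = w" using gh k by simp
  qed
  moreover have "s ` pts E \<subseteq> pts E" using gmaps_in[OF s] by auto
  ultimately have "bij_betw s (pts E) (pts E)"
    using endo_inj_surj[OF fin_gset_finite[OF fin_E]] by (auto simp: bij_betw_def)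
  then show ?thesis using s by (simp add: gset_iso_def)
qed

text \<open>Following \<open>s\<close> by \<open>f\<close> gives an endomorphism of
  \<open>E\<close>, hence an isomorphism. So every orbit of a G-set that maps to \<open>E\<close> is
  itself a copy of \<open>E\<close>.\<close>

lemma inj_section:
  assumes "s \<in> gmaps G E X" "f \<in> gmaps G X E"
  shows "inj_on s (pts E)"
proof -
  have "gset_iso G E E (\<lambda>z\<in>pts E. f (s z))"
    by (rule endo_iso) (rule comp_gmaps[OF fin_E assms])
  then show ?thesis by (auto simp: gset_iso_def bij_betw_def inj_on_def)
qed

section \<open>The ideal induced from an invariant ideal of the free orbit\<close>

definition orbitwise :: "'a set \<Rightarrow> ('g, 'u) gset \<Rightarrow> 'a set" where
  "orbitwise J X = {a \<in> val T X. \<forall>\<gamma>\<in>gmaps G E X. res T E X \<gamma> a \<in> J}"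

lemma orbitwise_res:
  assumes X: "fin_gset G X" and Y: "fin_gset G Y" and f: "f \<in> gmaps G X Y" and a: "a \<in> orbitwise J Y"
  shows "res T X Y f a \<in> orbitwise J X"
  unfolding orbitwise_def
proof (intro CollectI conjI ballI)
  have aV: "a \<in> val T Y" using a by (simp add: orbitwise_def)
  then show "res T X Y f a \<in> val T X" by (rule tr.R_closed[OF X Y f])
  fix \<gamma> assume \<gamma>: "\<gamma> \<in> gmaps G E X"
  have "res T E X \<gamma> (res T X Y f a) = res T E Y (\<lambda>z\<in>pts E. f (\<gamma> z)) a"
    by (rule tr.R_comp[OF fin_E X Y \<gamma> f comp_gmaps[OF fin_E \<gamma> f] _ aV]) simp
  then show "res T E X \<gamma> (res T X Y f a) \<in> J"
    using a comp_gmaps[OF fin_E \<gamma> f] by (auto simp: orbitwise_def)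
qed

text \<open>Every endomorphism of \<open>E\<close> is an automorphism, and its transfer and its norm
  are both the restriction along the inverse automorphism.\<close>

lemma invariant_ideal_endo:
  assumes J: "invariant_ideal G T E J" and t: "t \<in> gmaps G E E" and a: "a \<in> J"
  shows "res T E E t a \<in> J" "tran T E E t a \<in> J" "nrm T E E t a \<in> J"
proof -
  interpret ideal J "tring G T E" using J by (simp add: invariant_ideal_def)
  have aV: "a \<in> val T E" using a_Hcarr[OF a] by simp
  have res: "res T E E s a \<in> J" if "gset_iso G E E s" for s
    using J that a by (auto simp: invariant_ideal_def)
  then show "res T E E t a \<in> J" using endo_iso[OF t] by blast
  obtain k where k: "gset_iso G E E k" "\<And>x. x \<in> pts E \<Longrightarrow> k (t x) = x"
    "\<And>y. y \<in> pts E \<Longrightarrow> t (k y) = y"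
    using gset_iso_inverse[OF fin_E fin_E endo_iso[OF t]] by blast
  then have k': "k \<in> gmaps G E E" by (simp add: gset_iso_def)
  show "tran T E E t a \<in> J" "nrm T E E t a \<in> J"
    using res[OF k(1)] tr.S_iso[OF fin_E fin_E t k' k(2,3) aV] nm.S_iso[OF fin_E fin_E t k' k(2,3) aV]
    by simp_all
qed

text \<open>The orbit of any point of \<open>X\<close> is a copy of \<open>E\<close> because
  \<open>X\<close> lies over \<open>E\<close>. The drop in cardinality supports induction on the
  number of points.\<close>

lemma orbit_complement_obtain:
  fixes X :: "('g, 'u) gset"
  assumes X: "fin_gset G X" and f: "f \<in> gmaps G X E" and ne: "pts X \<noteq> {}"
  obtains Y :: "('g, 'u) gset" and s i fs fi where "disjoint_union G E Y X s i" "card (pts Y) < card (pts X)"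
    "fs \<in> gmaps G E E" "\<forall>z\<in>pts E. f (s z) = fs z"
    "fi \<in> gmaps G Y E" "\<forall>y\<in>pts Y. f (i y) = fi y"
proof -
  obtain x where x: "x \<in> pts X" using ne by blast
  obtain s where s: "s \<in> gmaps G E X" "s e = x" using orbit_map_exists[OF X x] by blast
  let ?Y = "gsub X (pts X - s ` pts E)"
  have du: "disjoint_union G E ?Y X s (gid ?Y)"
    by (rule disjoint_union_complement[OF fin_E X s(1) inj_section[OF s(1) f]])
  note d = disjoint_unionD[OF du]
  have "card (pts ?Y) < card (pts X)"
    by (rule psubset_card_mono[OF fin_gset_finite[OF X]]) (use x s e_in in auto)
  then show ?thesis
    using that[OF du _ comp_gmaps[OF fin_E s(1) f] _ comp_gmaps[OF d(2,5) f]] by simp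
qed

text \<open>Removing one orbit splits the transfer into a transfer along an automorphism of
  \<open>E\<close>, which preserves \<open>J\<close>, and a transfer from a smaller G-set.\<close>

lemma tran_orbitwise:
  assumes J: "invariant_ideal G T E J" and X: "fin_gset G X" and f: "f \<in> gmaps G X E"
    and b: "b \<in> orbitwise J X"
  shows "tran T X E f b \<in> J"
  using X f b
\<comment> \<open>Removing an orbit restricts the map and the element too, so \<open>f\<close> and
  \<open>b\<close> vary with \<open>X\<close>.\<close>
proof (induction "card (pts X)" arbitrary: X f b rule: less_induct)
  case less
  interpret ideal J "tring G T E" using J by (simp add: invariant_ideal_def)
  have bV: "b \<in> val T X" using less.prems(3) by (simp add: orbitwise_def)
  show ?case
  proof (cases "pts X = {}")
    case True
    then show ?thesis
      using tr.fold_unit_eq[OF fin_E less.prems(1) True less.prems(2) bV] ideal_closed(1)[OF ideal_axioms]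
      by simp
  next
    case False
    obtain Y :: "('g, 'u) gset" and s i fs fi where du: "disjoint_union G E Y X s i" and card: "card (pts Y) < card (pts X)"
      and fs: "fs \<in> gmaps G E E" "\<forall>z\<in>pts E. f (s z) = fs z"
      and fi: "fi \<in> gmaps G Y E" "\<forall>y\<in>pts Y. f (i y) = fi y"
      using orbit_complement_obtain[OF less.prems(1,2) False] by blast
    note d = disjoint_unionD[OF du]
    have "res T E X s b \<in> J" using less.prems(3) d(4) by (simp add: orbitwise_def)
    then have "tran T E E fs (res T E X s b) \<in> J" by (rule invariant_ideal_endo(2)[OF J fs(1)])
    moreover have "tran T Y E fi (res T Y X i b) \<in> J"
      by (rule less.hyps[OF card d(2) fi(1) orbitwise_res[OF d(2,3,5) less.prems(3)]])
    ultimately show ?thesis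
      using ideal_closed(2)[OF ideal_axioms]
        tr.S_disjoint_union[OF du fin_E less.prems(2) fs(1) bspec[OF fs(2)] fi(1) bspec[OF fi(2)] bV] by simp
  qed
qed

text \<open>No induction is called for: a product lies in \<open>J\<close> once one factor does, so
  splitting off a single orbit is enough. An empty \<open>X\<close> has to be excluded, as its norm
  is the empty product 1.\<close>

lemma nrm_orbitwise:
  assumes J: "invariant_ideal G T E J" and X: "fin_gset G X" "pts X \<noteq> {}" and f: "f \<in> gmaps G X E"
    and b: "b \<in> orbitwise J X"
  shows "nrm T X E f b \<in> J"
proof -
  interpret ideal J "tring G T E" using J by (simp add: invariant_ideal_def)
  have bV: "b \<in> val T X" using b by (simp add: orbitwise_def)
  obtain Y :: "('g, 'u) gset" and s i fs fi where du: "disjoint_union G E Y X s i"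
    and "card (pts Y) < card (pts X)"
    and fs: "fs \<in> gmaps G E E" "\<forall>z\<in>pts E. f (s z) = fs z"
    and fi: "fi \<in> gmaps G Y E" "\<forall>y\<in>pts Y. f (i y) = fi y"
    using orbit_complement_obtain[OF X(1) f X(2)] by blast
  note d = disjoint_unionD[OF du]
  have "res T E X s b \<in> J" using b d(4) by (simp add: orbitwise_def)
  then have "nrm T E E fs (res T E X s b) \<in> J" by (rule invariant_ideal_endo(3)[OF J fs(1)])
  moreover have "nrm T Y E fi (res T Y X i b) \<in> val T E"
    by (rule nm.S_closed[OF d(2) fin_E fi(1) tr.R_closed[OF d(2,3,5) bV]])
  ultimately show ?thesis
    using I_r_closed[of "nrm T E E fs (res T E X s b)"]
      nm.S_disjoint_union[OF du fin_E f fs(1) bspec[OF fs(2)] fi(1) bspec[OF fi(2)] bV] by simp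
qed

text \<open>An intersection of preimages of \<open>J\<close> under the restrictions along maps from
  \<open>E\<close>, which are ring homomorphisms.\<close>

lemma orbitwise_ideal:
  assumes J: "ideal J (tring G T E)" and X: "fin_gset G X"
  shows "ideal (orbitwise J X) (tring G T X)"
proof -
  interpret J: ideal J "tring G T E" by (rule J)
  interpret X: ring "tring G T X" by (rule tring_ring[OF X])
  have hom: "ring_hom_ring (tring G T X) (tring G T E) (res T E X \<gamma>)" if "\<gamma> \<in> gmaps G E X" for \<gamma>
    by (rule res_ring_hom[OF fin_E X that])
  have sub: "subgroup (orbitwise J X) (add_monoid (tring G T X))"
  proof (rule X.add.subgroupI)
    show "orbitwise J X \<subseteq> carrier (tring G T X)" by (auto simp: orbitwise_def)
    have "\<zero>\<^bsub>tring G T X\<^esub> \<in> orbitwise J X"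
      using ideal_closed(1)[OF J] X.zero_closed
      by (simp add: orbitwise_def tr.R_fold_unit[OF fin_E X])
    then show "orbitwise J X \<noteq> {}" by blast
    fix a assume a: "a \<in> orbitwise J X"
    then have aV: "a \<in> carrier (tring G T X)" by (simp add: orbitwise_def)
    have "res T E X \<gamma> (\<ominus>\<^bsub>tring G T X\<^esub> a) \<in> J" if "\<gamma> \<in> gmaps G E X" for \<gamma>
    proof -
      interpret h: ring_hom_ring "tring G T X" "tring G T E" "res T E X \<gamma>" by (rule hom[OF that])
      show ?thesis using a that aV ideal_closed(3)[OF J] by (simp add: orbitwise_def h.hom_a_inv)
    qed
    then show "\<ominus>\<^bsub>tring G T X\<^esub> a \<in> orbitwise J X"
      using X.a_inv_closed[OF aV] by (simp add: orbitwise_def)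
    fix b assume b: "b \<in> orbitwise J X"
    show "a \<oplus>\<^bsub>tring G T X\<^esub> b \<in> orbitwise J X"
      using a b X.a_closed[of a b] ideal_closed(2)[OF J]
      by (simp add: orbitwise_def tr.R_fold_op[OF fin_E X])
  qed
  show ?thesis
  proof (rule idealI[OF X.ring_axioms sub])
    fix a x assume a: "a \<in> orbitwise J X" and x: "x \<in> carrier (tring G T X)"
    show "x \<otimes>\<^bsub>tring G T X\<^esub> a \<in> orbitwise J X"
      using a x X.m_closed[of x a] J.I_l_closed tr.R_closed[OF fin_E X]
      by (simp add: orbitwise_def nm.R_fold_op[OF fin_E X])
    show "a \<otimes>\<^bsub>tring G T X\<^esub> x \<in> orbitwise J X"
      using a x X.m_closed[of a x] J.I_r_closed tr.R_closed[OF fin_E X]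
      by (simp add: orbitwise_def nm.R_fold_op[OF fin_E X])
  qed
qed

lemma orbitwise_tambara_ideal:
  assumes J: "invariant_ideal G T E J"
  shows "tambara_ideal G T (orbitwise J)"
  unfolding tambara_ideal_def
proof (intro conjI allI impI)
  have J': "ideal J (tring G T E)" using J by (simp add: invariant_ideal_def)
  then show "ideal (orbitwise J X) (tring G T X)" if "fin_gset G X" for X
    using that by (rule orbitwise_ideal)
  fix X Y :: "('g, 'u) gset" and f assume *: "fin_gset G X \<and> fin_gset G Y \<and> f \<in> gmaps G X Y"
  then have X: "fin_gset G X" and Y: "fin_gset G Y" and f: "f \<in> gmaps G X Y" by auto
  show "res T X Y f ` orbitwise J Y \<subseteq> orbitwise J X"
    using orbitwise_res[OF X Y f] by blast
  show "tran T X Y f ` orbitwise J X \<subseteq> orbitwise J Y"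
  proof
    fix c assume "c \<in> tran T X Y f ` orbitwise J X"
    then obtain a where a: "a \<in> orbitwise J X" "c = tran T X Y f a" by blast
    then have aV: "a \<in> val T X" by (simp add: orbitwise_def)
    have "res T E Y \<gamma> c \<in> J" if \<gamma>: "\<gamma> \<in> gmaps G E Y" for \<gamma>
    proof -
      \<comment> \<open>Pulling \<open>f\<close> back along \<open>\<gamma>\<close> replaces the
        target by \<open>E\<close>, where the transfer can be evaluated orbit by orbit.\<close>
      obtain X' :: "('g, 'u) gset" and f' \<xi> where pb: "is_pullback G X' E X Y f' \<xi> \<gamma> f"
        using pullback_exists[OF infinite_univ fin_E X Y \<gamma> f] by blast
      then have X': "fin_gset G X'" "f' \<in> gmaps G X' E" "\<xi> \<in> gmaps G X' X"
        by (auto simp: is_pullback_def)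
      show ?thesis
        unfolding a(2) tr.base_change[OF pb aV]
        by (rule tran_orbitwise[OF J X'(1,2) orbitwise_res[OF X'(1) X X'(3) a(1)]])
    qed
    then show "c \<in> orbitwise J Y" using tr.S_closed[OF X Y f aV] a by (simp add: orbitwise_def)
  qed
  show "nrm T X Y f ` orbitwise J X \<subseteq>
      {nrm T X Y f \<zero>\<^bsub>tring G T X\<^esub> \<oplus>\<^bsub>tring G T Y\<^esub> b |b. b \<in> orbitwise J Y}"
  proof
    fix c assume "c \<in> nrm T X Y f ` orbitwise J X"
    then obtain a where a: "a \<in> orbitwise J X" "c = nrm T X Y f a" by blast
    then have aV: "a \<in> val T X" by (simp add: orbitwise_def)
    interpret OX: ideal "orbitwise J X" "tring G T X" by (rule orbitwise_ideal[OF J' X])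
    interpret J: ideal J "tring G T E" by (rule J')
    interpret Y: cring "tring G T Y" by (rule tring_cring[OF Y])
    let ?z = "\<zero>\<^bsub>tring G T X\<^esub>"
    let ?n = "nrm T X Y f"
    have zV: "?z \<in> val T X" and z: "?z \<in> orbitwise J X"
      using tr.fold_unit_closed[OF X] ideal_closed(1)[OF OX.ideal_axioms] by simp_all
    have nV: "?n a \<in> carrier (tring G T Y)" "?n ?z \<in> carrier (tring G T Y)"
      using nm.S_closed[OF X Y f] aV zV by simp_all
    \<comment> \<open>The only candidate for the summand that the ideal condition requires; it
      remains to test it on \<open>E\<close>.\<close>
    define b where "b = ?n a \<ominus>\<^bsub>tring G T Y\<^esub> ?n ?z"
    have bV: "b \<in> carrier (tring G T Y)" unfolding b_def using nV by (rule Y.minus_closed)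
    have "res T E Y \<gamma> b \<in> J" if \<gamma>: "\<gamma> \<in> gmaps G E Y" for \<gamma>
    proof -
      obtain X' :: "('g, 'u) gset" and f' \<xi> where pb: "is_pullback G X' E X Y f' \<xi> \<gamma> f"
        using pullback_exists[OF infinite_univ fin_E X Y \<gamma> f] by blast
      then have X': "fin_gset G X'" "f' \<in> gmaps G X' E" "\<xi> \<in> gmaps G X' X"
        by (auto simp: is_pullback_def)
      interpret h: ring_hom_ring "tring G T Y" "tring G T E" "res T E Y \<gamma>"
        by (rule res_ring_hom[OF fin_E Y \<gamma>])
      let ?N = "\<lambda>w. nrm T X' E f' (res T X' X \<xi> w)"
      have NV: "?N w \<in> carrier (tring G T E)" if "w \<in> val T X" for w
        using nm.S_closed[OF X'(1) fin_E X'(2) tr.R_closed[OF X'(1) X X'(3) that]] by simp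
      have "res T E Y \<gamma> b = res T E Y \<gamma> (?n a) \<ominus>\<^bsub>tring G T E\<^esub> res T E Y \<gamma> (?n ?z)"
        unfolding b_def a_minus_def using nV by (simp only: h.hom_add h.hom_a_inv Y.a_inv_closed)
      also have "\<dots> = ?N a \<ominus>\<^bsub>tring G T E\<^esub> ?N ?z"
        by (simp only: nm.base_change[OF pb aV] nm.base_change[OF pb zV])
      also have "\<dots> \<in> J"
      \<comment> \<open>With nothing over the image of \<open>\<gamma>\<close>, the value at
        \<open>X'\<close> is a single element and the two norms coincide; otherwise each of them
        lies in \<open>J\<close>.\<close>
      proof (cases "pts X' = {}")
        case True
        then have "res T X' X \<xi> a = res T X' X \<xi> ?z"
          by (intro tr.V_empty_eq[OF X'(1)] tr.R_closed[OF X'(1) X X'(3)] aV zV)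
        then show ?thesis
          using J.r_neg[OF NV[OF zV]] ideal_closed(1)[OF J'] by (simp only: a_minus_def)
      next
        case False
        have "?N w \<in> J" if "w \<in> orbitwise J X" for w
          by (rule nrm_orbitwise[OF J X'(1) False X'(2) orbitwise_res[OF X'(1) X X'(3) that]])
        then show ?thesis
          unfolding a_minus_def using a z by (intro ideal_closed(2,3)[OF J']) auto
      qed
      finally show ?thesis .
    qed
    then have "b \<in> orbitwise J Y" using bV by (simp add: orbitwise_def)
    moreover have "?n a = ?n ?z \<oplus>\<^bsub>tring G T Y\<^esub> b"
      unfolding b_def a_minus_def using nV
      by (simp only: Y.a_lcomm[of "?n ?z" "?n a"] Y.a_inv_closed Y.r_neg Y.r_zero)
    ultimately show "c \<in> {nrm T X Y f \<zero>\<^bsub>tring G T X\<^esub> \<oplus>\<^bsub>tring G T Y\<^esub> b |b. b \<in> orbitwise J Y}"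
      using a(2) by blast
  qed
qed

text \<open>The identity of \<open>E\<close> is among the test maps, and the other endomorphisms
  preserve \<open>J\<close>. Since ideals are closed under restriction, \<open>orbitwise J\<close>
  is thus the largest ideal with value \<open>J\<close> at \<open>E\<close>.\<close>

lemma orbitwise_orbit:
  assumes J: "invariant_ideal G T E J"
  shows "orbitwise J E = J"
proof
  interpret ideal J "tring G T E" using J by (simp add: invariant_ideal_def)
  show "orbitwise J E \<subseteq> J"
  proof
    fix a assume "a \<in> orbitwise J E"
    then show "a \<in> J" using tr.R_gid[OF fin_E, of a] id_gmaps[OF fin_E] unfolding orbitwise_def by force
  qed
  show "J \<subseteq> orbitwise J E"
    using a_Hcarr invariant_ideal_endo(1)[OF J] by (auto simp: orbitwise_def)
qed

section \<open>Consequences of being field-like\<close>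

lemma tambara_ideal_invariant:
  assumes "tambara_ideal G T I"
  shows "invariant_ideal G T E (I E)"
  using assms fin_E unfolding tambara_ideal_def invariant_ideal_def gset_iso_def by blast

lemma field_like_orbitwise:
  assumes fl: "field_like G T" and J: "invariant_ideal G T E J"
    and ne: "J \<noteq> carrier (tring G T E)" and X: "fin_gset G X"
  shows "orbitwise J X \<subseteq> {\<zero>\<^bsub>tring G T X\<^esub>}"
proof -
  have J': "ideal J (tring G T E)" using J by (simp add: invariant_ideal_def)
  have "orbitwise J E \<noteq> val T E" using ne orbitwise_orbit[OF J] by simp
  then have proper: "proper_tambara_ideal G T (orbitwise J)"
    unfolding proper_tambara_ideal_def using orbitwise_tambara_ideal[OF J] fin_E by blast
  have le: "ideal_le G (\<lambda>X. {\<zero>\<^bsub>tring G T X\<^esub>}) (orbitwise J)"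
    unfolding ideal_le_def
  proof (intro allI impI)
    fix Y :: "('g, 'u) gset" assume "fin_gset G Y"
    then interpret ideal "orbitwise J Y" "tring G T Y" by (rule orbitwise_ideal[OF J'])
    show "{\<zero>\<^bsub>tring G T Y\<^esub>} \<subseteq> orbitwise J Y"
      using ideal_closed(1)[OF ideal_axioms] by blast
  qed
  have "ideal_le G (orbitwise J) (\<lambda>X. {\<zero>\<^bsub>tring G T X\<^esub>})"
    using fl[unfolded field_like_def maximal_tambara_ideal_def, THEN conjunct2, rule_format,
        OF conjI[OF proper le]] .
  then show ?thesis using X by (simp add: ideal_le_def)
qed

lemma field_like_invariant_ideal:
  assumes fl: "field_like G T" and J: "invariant_ideal G T E J"
  shows "J = {\<zero>\<^bsub>tring G T E\<^esub>} \<or> J = carrier (tring G T E)"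
proof (rule disjCI)
  assume ne: "J \<noteq> carrier (tring G T E)"
  interpret ideal J "tring G T E" using J by (simp add: invariant_ideal_def)
  show "J = {\<zero>\<^bsub>tring G T E\<^esub>}"
    using field_like_orbitwise[OF fl J ne fin_E] ideal_closed(1)[OF ideal_axioms] unfolding orbitwise_orbit[OF J] by auto
qed

lemma zero_invariant: "invariant_ideal G T E {\<zero>\<^bsub>tring G T E\<^esub>}"
  using tambara_ideal_invariant[OF zero_tambara_ideal] .

lemma field_like_separated:
  assumes fl: "field_like G T" and X: "fin_gset G X" and a: "a \<in> val T X"
    and z: "\<And>\<gamma>. \<gamma> \<in> gmaps G E X \<Longrightarrow> res T E X \<gamma> a = \<zero>\<^bsub>tring G T E\<^esub>"
  shows "a = \<zero>\<^bsub>tring G T X\<^esub>"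
proof -
  let ?J = "{\<zero>\<^bsub>tring G T E\<^esub>}"
  interpret ring "tring G T E" by (rule tring_ring[OF fin_E])
  \<comment> \<open>If the ring at the free orbit were zero, then 1 = 0 there, and a unit in the
    zero ideal over the nonempty \<open>E\<close> would make every value zero, against
    properness.\<close>
  have "?J \<noteq> carrier (tring G T E)"
  proof
    assume "?J = carrier (tring G T E)"
    then have "\<one>\<^bsub>tring G T E\<^esub> \<in> ?J" using one_closed by simp
    then have "{\<zero>\<^bsub>tring G T X\<^esub>} = val T X" if "fin_gset G X" for X
      using tambara_ideal_eq_top[OF zero_tambara_ideal fin_E _ _ that] e_in by blast
    moreover have "\<exists>X. fin_gset G X \<and> {\<zero>\<^bsub>tring G T X\<^esub>} \<noteq> val T X"
      using fl unfolding field_like_def maximal_tambara_ideal_def proper_tambara_ideal_def by (elim conjE)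
    ultimately show False by auto
  qed
  from field_like_orbitwise[OF fl zero_invariant this X] a z show ?thesis
    by (auto simp: orbitwise_def)
qed

section \<open>Orbits and (MRC)\<close>

lemma transitive_gsetD:
  assumes "transitive_gset G X"
  shows "fin_gset G X" "pts X \<noteq> {}"
    "x \<in> pts X \<Longrightarrow> y \<in> pts X \<Longrightarrow> \<exists>g\<in>carrier G. act X g x = y"
proof -
  interpret transitive_action G "pts X" "act X" using assms by (simp add: transitive_gset_def)
  show "fin_gset G X" "pts X \<noteq> {}"
    using assms group_action_axioms by (simp_all add: transitive_gset_def fin_gset_def)
  show "x \<in> pts X \<Longrightarrow> y \<in> pts X \<Longrightarrow> \<exists>g\<in>carrier G. act X g x = y" by (rule unique_orbit)
qed

lemma transitive_gsetI:
  assumes "fin_gset G X" "pts X \<noteq> {}"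
    and "\<And>x y. x \<in> pts X \<Longrightarrow> y \<in> pts X \<Longrightarrow> \<exists>g\<in>carrier G. act X g x = y"
  shows "transitive_gset G X"
proof -
  interpret group_action G "pts X" "act X" using assms(1) by (simp add: fin_gset_def)
  have "transitive_action G (pts X) (act X)" by unfold_locales (rule assms(3))
  then show ?thesis using assms(1,2) by (simp add: transitive_gset_def fin_gset_def)
qed

lemma orbit_transitive:
  assumes X: "fin_gset G X" and x: "x \<in> pts X"
  defines "orb \<equiv> {act X g x |g. g \<in> carrier G}"
  shows "transitive_gset G (gsub X orb)" "gid (gsub X orb) \<in> gmaps G (gsub X orb) X" "x \<in> orb"
proof -
  have sub: "orb \<subseteq> pts X" using act_in[OF X _ x] by (auto simp: orb_def)
  have cl: "act X g z \<in> orb" if "g \<in> carrier G" "z \<in> orb" for g z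
    using that act_mult[OF X _ _ x, symmetric] unfolding orb_def by fastforce
  show xo: "x \<in> orb" using act_one[OF X x] unfolding orb_def by force
  show "gid (gsub X orb) \<in> gmaps G (gsub X orb) X" by (rule fin_gset_gsub(2)[OF X sub cl])
  show "transitive_gset G (gsub X orb)"
  proof (rule transitive_gsetI)
    show "fin_gset G (gsub X orb)" by (rule fin_gset_gsub(1)[OF X sub cl])
    fix z w assume "z \<in> pts (gsub X orb)" "w \<in> pts (gsub X orb)"
    then obtain g h where gh: "g \<in> carrier G" "z = act X g x" "h \<in> carrier G" "w = act X h x"
      by (auto simp: orb_def)
    then have "act X (h \<otimes> inv g) z = w"
      using act_mult[OF X _ _ act_in[OF X gh(1) x], of h "inv g"] act_inv(1)[OF X gh(1) x] by simp
    then show "\<exists>k\<in>carrier G. act (gsub X orb) k z = w"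
      using gh \<open>z \<in> pts (gsub X orb)\<close> by (intro bexI[of _ "h \<otimes> inv g"]) auto
  qed (use xo in auto)
qed

lemma transitive_E: "transitive_gset G E"
proof (rule transitive_gsetI[OF fin_E])
  show "pts E \<noteq> {}" using e_in by blast
  fix z w assume "z \<in> pts E" "w \<in> pts E"
  then obtain g h where gh: "g \<in> carrier G" "z = act E g e" "h \<in> carrier G" "w = act E h e"
    using free unfolding bij_betw_def by blast
  then have "act E (h \<otimes> inv g) z = w"
    using act_mult[OF fin_E _ _ act_in[OF fin_E gh(1) e_in], of h "inv g"]
      act_inv(1)[OF fin_E gh(1) e_in] by simp
  then show "\<exists>k\<in>carrier G. act E k z = w" using gh by (intro bexI[of _ "h \<otimes> inv g"]) auto
qed

text \<open>(MRC) speaks of transitive G-sets only; additivity extends it. One map from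
  \<open>E\<close> detects zero on a single orbit, and the complement of the orbit is handled by
  induction.\<close>

lemma MRC_separated:
  assumes mrc: "MRC G T" and X: "fin_gset G X" and a: "a \<in> val T X"
    and z: "\<And>\<gamma>. \<gamma> \<in> gmaps G E X \<Longrightarrow> res T E X \<gamma> a = \<zero>\<^bsub>tring G T E\<^esub>"
  shows "a = \<zero>\<^bsub>tring G T X\<^esub>"
  using X a z
proof (induction "card (pts X)" arbitrary: X a rule: less_induct)
  case less
  note X = less.prems(1) and a = less.prems(2)
  show ?case
  proof (cases "pts X = {}")
    case True
    show ?thesis
      by (rule tr.V_empty_eq[OF X True a]) (simp add: tr.fold_unit_closed[OF X])
  next
    case False
    then obtain x where x: "x \<in> pts X" by blast
    define O' where "O' = gsub X {act X g x |g. g \<in> carrier G}"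
    have O: "transitive_gset G O'" "gid O' \<in> gmaps G O' X" and xO: "x \<in> pts O'"
      using orbit_transitive[OF X x] by (simp_all add: O'_def)
    note fO = transitive_gsetD(1)[OF O(1)]
    define Y where "Y = gsub X (pts X - gid O' ` pts O')"
    have du: "disjoint_union G O' Y X (gid O') (gid Y)"
      unfolding Y_def by (rule disjoint_union_complement[OF fO X O(2)]) simp
    note d = disjoint_unionD[OF du]
    have rest: "res T E W \<gamma> (res T W X i a) = \<zero>\<^bsub>tring G T E\<^esub>"
      if "fin_gset G W" "\<gamma> \<in> gmaps G E W" "i \<in> gmaps G W X" for W \<gamma> i
      using tr.R_comp[OF fin_E that(1) X that(2,3) comp_gmaps[OF fin_E that(2,3)] _ a]
        less.prems(3)[OF comp_gmaps[OF fin_E that(2,3)]] by simp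
    obtain \<gamma> where \<gamma>: "\<gamma> \<in> gmaps G E O'" using orbit_map_exists[OF fO xO] by blast
    have "res T O' X (gid O') a = \<zero>\<^bsub>tring G T O'\<^esub>"
    proof (rule inj_onD)
      show "inj_on (res T E O' \<gamma>) (val T O')"
        using mrc transitive_E O(1) \<gamma> unfolding MRC_def by blast
      show "res T E O' \<gamma> (res T O' X (gid O') a) = res T E O' \<gamma> \<zero>\<^bsub>tring G T O'\<^esub>"
        using rest[OF fO \<gamma> O(2)] tr.R_fold_unit[OF fin_E fO \<gamma>] by simp
      show "res T O' X (gid O') a \<in> val T O'" by (rule tr.R_closed[OF fO X O(2) a])
    qed (simp add: tr.fold_unit_closed[OF fO])
    moreover have "res T Y X (gid Y) a = \<zero>\<^bsub>tring G T Y\<^esub>"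
    proof (rule less.hyps[OF _ d(2)])
      show "card (pts Y) < card (pts X)"
        by (rule psubset_card_mono[OF fin_gset_finite[OF X]]) (use x xO in \<open>auto simp: Y_def\<close>)
      show "res T Y X (gid Y) a \<in> val T Y" by (rule tr.R_closed[OF d(2) X d(5) a])
    qed (rule rest[OF d(2) _ d(5)])
    ultimately show ?thesis
      using tr.coproduct_eqI[OF disjoint_union_is_coproduct[OF du] a tr.fold_unit_closed[OF X]]
        tr.R_fold_unit[OF fO X O(2)] tr.R_fold_unit[OF d(2) X d(5)] by simp
  qed
qed

text \<open>Every map from \<open>E\<close> to \<open>Y\<close> factors through \<open>f\<close>,
  because \<open>f\<close> is onto the transitive \<open>Y\<close> and a map out of \<open>E\<close>
  may start at any point. So if \<open>a\<close> and \<open>b\<close> agree on \<open>X\<close>,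
  their difference vanishes on \<open>E\<close> along every map and is zero by
  \<open>field_like_separated\<close>.\<close>

lemma field_like_MRC:
  assumes fl: "field_like G T"
  shows "MRC G T"
  unfolding MRC_def
proof (intro allI impI inj_onI)
  fix X Y :: "('g, 'u) gset" and f a b
  assume "transitive_gset G X \<and> transitive_gset G Y \<and> f \<in> gmaps G X Y"
  then have tX: "transitive_gset G X" and tY: "transitive_gset G Y" and f: "f \<in> gmaps G X Y" by auto
  assume aV: "a \<in> val T Y" and bV: "b \<in> val T Y" and eq: "res T X Y f a = res T X Y f b"
  note X = transitive_gsetD(1)[OF tX] and Y = transitive_gsetD(1)[OF tY]
  interpret ring "tring G T Y" by (rule tring_ring[OF Y])
  have "a \<ominus>\<^bsub>tring G T Y\<^esub> b = \<zero>\<^bsub>tring G T Y\<^esub>"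
  proof (rule field_like_separated[OF fl Y])
    show "a \<ominus>\<^bsub>tring G T Y\<^esub> b \<in> val T Y" using minus_closed[of a b] aV bV by simp
    fix \<gamma> assume \<gamma>: "\<gamma> \<in> gmaps G E Y"
    interpret h: ring_hom_ring "tring G T Y" "tring G T E" "res T E Y \<gamma>"
      by (rule res_ring_hom[OF fin_E Y \<gamma>])
    obtain x0 where x0: "x0 \<in> pts X" using transitive_gsetD(2)[OF tX] by blast
    \<comment> \<open>\<open>g\<close> carries \<open>f x0\<close> to \<open>\<gamma> e\<close>, so
      \<open>act X g x0\<close> is a point above \<open>\<gamma> e\<close> to which \<open>e\<close>
      can be lifted.\<close>
    obtain g where g: "g \<in> carrier G" "act Y g (f x0) = \<gamma> e"
      using transitive_gsetD(3)[OF tY gmaps_in[OF f x0] gmaps_in[OF \<gamma> e_in]] by blast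
    obtain \<delta> where \<delta>: "\<delta> \<in> gmaps G E X" "\<delta> e = act X g x0"
      using orbit_map_exists[OF X act_in[OF X g(1) x0]] by blast
    have "\<gamma> = (\<lambda>z\<in>pts E. f (\<delta> z))"
      by (rule orbit_map_eqI[OF \<gamma> comp_gmaps[OF fin_E \<delta>(1) f]])
        (simp add: e_in \<delta> gmaps_act[OF f g(1) x0] g)
    then have c: "res T E Y \<gamma> w = res T E X \<delta> (res T X Y f w)" if "w \<in> val T Y" for w
      using tr.R_comp[OF fin_E X Y \<delta>(1) f \<gamma> _ that] by simp
    have "res T E Y \<gamma> a = res T E Y \<gamma> b" using c aV bV eq by simp
    moreover have "res T E Y \<gamma> (a \<ominus>\<^bsub>tring G T Y\<^esub> b) =
        res T E Y \<gamma> a \<ominus>\<^bsub>tring G T E\<^esub> res T E Y \<gamma> b"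
      unfolding a_minus_def using aV bV h.hom_add[of a "\<ominus>\<^bsub>tring G T Y\<^esub> b"] h.hom_a_inv[of b] a_inv_closed[of b] by simp
    ultimately show "res T E Y \<gamma> (a \<ominus>\<^bsub>tring G T Y\<^esub> b) = \<zero>\<^bsub>tring G T E\<^esub>"
      unfolding a_minus_def using h.S.r_neg[of "res T E Y \<gamma> b"] h.hom_closed[of b] bV by simp
  qed
  then have "\<ominus>\<^bsub>tring G T Y\<^esub> (\<ominus>\<^bsub>tring G T Y\<^esub> b) = a"
    using aV bV a_inv_closed[of b] by (intro minus_equality) (simp_all add: a_minus_def)
  then show "a = b" using minus_minus[of b] bV by simp
qed

lemma field_likeI:
  assumes nz: "nonzero_tambara G T" and mrc: "MRC G T"
    and inv: "\<And>J. invariant_ideal G T E J \<Longrightarrow> J = {\<zero>\<^bsub>tring G T E\<^esub>} \<or> J = carrier (tring G T E)"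
  shows "field_like G T"
  unfolding field_like_def maximal_tambara_ideal_def
proof (intro conjI allI impI)
  \<comment> \<open>Nonvanishing of \<open>T\<close> is properness of the zero ideal.\<close>
  show "proper_tambara_ideal G T (\<lambda>X. {\<zero>\<^bsub>tring G T X\<^esub>})"
    using nz zero_tambara_ideal unfolding nonzero_tambara_def proper_tambara_ideal_def by metis
next
  fix I assume "proper_tambara_ideal G T I \<and> ideal_le G (\<lambda>X. {\<zero>\<^bsub>tring G T X\<^esub>}) I"
  then have I: "tambara_ideal G T I" and proper: "\<exists>X. fin_gset G X \<and> I X \<noteq> val T X"
    by (auto simp: proper_tambara_ideal_def)
  interpret E: ring "tring G T E" by (rule tring_ring[OF fin_E])
  have "\<one>\<^bsub>tring G T E\<^esub> \<notin> I E"
    using tambara_ideal_eq_top[OF I fin_E] e_in proper by blast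
  then have "I E \<noteq> carrier (tring G T E)" using E.one_closed by blast
  then have IE: "I E = {\<zero>\<^bsub>tring G T E\<^esub>}" using inv[OF tambara_ideal_invariant[OF I]] by blast
  show "ideal_le G I (\<lambda>X. {\<zero>\<^bsub>tring G T X\<^esub>})"
    unfolding ideal_le_def
  proof (intro allI impI subsetI singletonI)
    fix X a assume X: "fin_gset G X" and a: "a \<in> I X"
    interpret ideal "I X" "tring G T X" using I X by (simp add: tambara_ideal_def)
    have "res T E X \<gamma> a = \<zero>\<^bsub>tring G T E\<^esub>" if "\<gamma> \<in> gmaps G E X" for \<gamma>
      using I fin_E X that a IE unfolding tambara_ideal_def by blast
    then have "a = \<zero>\<^bsub>tring G T X\<^esub>" using MRC_separated[OF mrc X] a_Hcarr[OF a] by simp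
    then show "a \<in> {\<zero>\<^bsub>tring G T X\<^esub>}" by simp
  qed
qed

end

text \<open>The cosets of the trivial subgroup are the singletons, on which G acts simply
  transitively; the base point is the image of the coset of the unit.\<close>

lemma (in group) free_orbit_basepoint:
  assumes E: "fin_gset G E" and h: "gset_iso G (coset_gset G {\<one>}) E h"
  shows "h {\<one>} \<in> pts E" "bij_betw (\<lambda>g. act E g (h {\<one>})) (carrier G) (pts E)"
proof -
  have c: "g <# {\<one>} = {g}" if "g \<in> carrier G" for g using that by (simp add: l_coset_def)
  have p: "pts (coset_gset G {\<one>}) = (\<lambda>g. {g}) ` carrier G"
    by (auto simp: coset_gset_def LCOSETS_def c)
  have hm: "h \<in> gmaps G (coset_gset G {\<one>}) E"
    and hb: "bij_betw h ((\<lambda>g. {g}) ` carrier G) (pts E)"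
    using h by (auto simp: gset_iso_def p)
  have o: "{\<one>} \<in> pts (coset_gset G {\<one>})" by (simp add: p)
  show "h {\<one>} \<in> pts E" by (rule gmaps_in[OF hm o])
  have "act E g (h {\<one>}) = h {g}" if "g \<in> carrier G" for g
    using gmaps_act[OF hm that o] o c[OF that] by (simp add: coset_gset_def)
  moreover have "bij_betw (\<lambda>g. h {g}) (carrier G) (pts E)"
    using bij_betw_trans[OF _ hb, of "\<lambda>g. {g}" "carrier G"]
    by (simp add: bij_betw_def inj_on_def o_def)
  ultimately show "bij_betw (\<lambda>g. act E g (h {\<one>})) (carrier G) (pts E)"
    by (simp cong: bij_betw_cong)
qed

theorem theorem4p32:
  fixes G :: "('g, 'm) monoid_scheme"
    and T :: "('g, 'u, 'a) tambara"
    and E :: "('g, 'u) gset"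
  assumes "group G" and "finite (carrier G)"
    and "infinite (UNIV :: 'u set)"
    and "tambara_functor G T" and "nonzero_tambara G T"
    and "fin_gset G E" and "\<exists>h. gset_iso G (coset_gset G {\<one>\<^bsub>G\<^esub>}) E h"
  shows "field_like G T \<longleftrightarrow>
    MRC G T \<and>
    (\<forall>J. invariant_ideal G T E J \<longrightarrow> J = {\<zero>\<^bsub>tring G T E\<^esub>} \<or> J = carrier (tring G T E))"
proof -
  interpret group G by (rule assms(1))
  obtain h where h: "gset_iso G (coset_gset G {\<one>\<^bsub>G\<^esub>}) E h" using assms(7) by blast
  interpret tambara_free_orbit G T E "h {\<one>\<^bsub>G\<^esub>}"
    by unfold_locales (use assms free_orbit_basepoint[OF assms(6) h] in auto)
  show ?thesis
    using field_like_MRC field_like_invariant_ideal field_likeI[OF assms(5)] by blast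
qed

end
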